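(* Let $\Omega\subset\mathbb{R}^N$ be a bounded domain with $\mathcal{C}^2$-boundary, let $p>1$ and $q<p$. Let $g\in\mathcal{C}^1(\mathbb{R},\mathbb{R}^N)$ and let $G:\mathbb{R}\to\mathbb{R}^N$ be a primitive of $g$ (i.e. $G'=g$) satisfying $$\limsup_{\omega\to\infty}\frac{|G(\omega)|}{\omega^q}<\infty .$$ Let $\sigma\in\mathcal{C}^1_b(\partial\Omega\times(0,\infty))$ with $\sigma\ge0$, and let $u_0\in\mathcal{C}(\overline\Omega)$ with $u_0\ge 0$, $u_0\not\equiv0$. Then every positive (maximal classical) solution of $$\begin{cases}\partial_t u=\Delta u-g(u)\cdot\nabla u+u^p & \text{in }\overline\Omega\text{ for }t>0,\\ \sigma\,\partial_t u+\partial_\nu u=0 & \text{on }\partial\Omega\text{ for }t>0,\\ u(\cdot,0)=u_0 & \text{in }\overline\Omega,\end{cases}$$ blows up in finite time.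
   Context: $\nu$ is the outer unit normal field on $\partial\Omega$ and $\partial_\nu$ the outer normal derivative. $\mathcal{C}^1_b$ denotes $\mathcal{C}^1$ functions that are bounded with bounded first derivatives. The unique maximal classical solution is $u\in\mathcal{C}(\overline\Omega\times[0,T))\cap\mathcal{C}^{2,1}(\overline\Omega\times(0,T))$, where $T\in(0,\infty]$ is the maximal existence time, which coincides with the blow-up time in the $L^\infty$-norm: $T=\inf\{s>0 : \lim_{t\nearrow s}\sup_{x\in\overline\Omega}|u(x,t)|=\infty\}$. Blow-up in finite time means $T<\infty$. *)

theory Defs
  imports "HOL-Analysis.Analysis"
begin

definition C2_function :: "('a::euclidean_space \<Rightarrow> real) \<Rightarrow> bool" where
  "C2_function f \<longleftrightarrow>
     (\<exists>D H. (\<forall>x. (f has_derivative (\<lambda>h. D x \<bullet> h)) (at x)) \<and>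
            (\<forall>x. (D has_derivative H x) (at x)) \<and>
            (\<forall>k. continuous_on UNIV (\<lambda>x. H x k)))"

text \<open>Near each boundary point, in coordinates rotated so that the unit vector \<open>e\<close> is the last
  axis, the domain lies strictly above the graph of a \<open>C\<^sup>2\<close> function of the remaining coordinates:
  \<open>x - (x \<bullet> e) *\<^sub>R e\<close> is the projection of \<open>x\<close> to the hyperplane orthogonal to \<open>e\<close>. (Any \<open>C\<^sup>2\<close> function
  on that hyperplane extends to the whole space by composing with the projection.)\<close>

definition C2_boundary :: "'a::euclidean_space set \<Rightarrow> bool" where
  "C2_boundary \<Omega> \<longleftrightarrow>
     (\<forall>z\<in>frontier \<Omega>. \<exists>r>0. \<exists>e \<gamma>. norm e = 1 \<and> C2_function \<gamma> \<and>
        \<Omega> \<inter> ball z r = {x \<in> ball z r. \<gamma> (x - (x \<bullet> e) *\<^sub>R e) < x \<bullet> e})"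

definition bounded_C2_domain :: "'a::euclidean_space set \<Rightarrow> bool" where
  "bounded_C2_domain \<Omega> \<longleftrightarrow>
     open \<Omega> \<and> connected \<Omega> \<and> \<Omega> \<noteq> {} \<and> bounded \<Omega> \<and> C2_boundary \<Omega>"

text \<open>The unit vector \<open>n\<close> is the outer normal at \<open>x\<close> if every direction on the negative side of the
  hyperplane orthogonal to \<open>n\<close> points into the domain and every direction on the positive side
  points out of it.\<close>

definition is_outer_unit_normal :: "'a::euclidean_space set \<Rightarrow> 'a \<Rightarrow> 'a \<Rightarrow> bool" where
  "is_outer_unit_normal \<Omega> x n \<longleftrightarrow> norm n = 1 \<and>
     (\<forall>h. h \<bullet> n < 0 \<longrightarrow> (\<forall>\<^sub>F s in at_right 0. x + s *\<^sub>R h \<in> \<Omega>)) \<and>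
     (\<forall>h. h \<bullet> n > 0 \<longrightarrow> (\<forall>\<^sub>F s in at_right 0. x + s *\<^sub>R h \<notin> closure \<Omega>))"

lemma is_outer_unit_normal_unique:
  assumes n: "is_outer_unit_normal \<Omega> x n" and m: "is_outer_unit_normal \<Omega> x m"
  shows "n = m"
proof (rule ccontr)
  assume "n \<noteq> m"
  have 1: "n \<bullet> n = 1" "m \<bullet> m = 1"
    using n m by (auto simp: is_outer_unit_normal_def norm_eq_1)
  have "0 < (m - n) \<bullet> (m - n)"
    using \<open>n \<noteq> m\<close> by simp
  hence "(m - n) \<bullet> n < 0" "(m - n) \<bullet> m > 0"
    using 1 by (simp_all add: inner_diff_left inner_diff_right inner_commute)
  hence "\<forall>\<^sub>F s in at_right 0. x + s *\<^sub>R (m - n) \<in> \<Omega>"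
        "\<forall>\<^sub>F s in at_right 0. x + s *\<^sub>R (m - n) \<notin> closure \<Omega>"
    using n m by (auto simp: is_outer_unit_normal_def)
  hence "\<forall>\<^sub>F s in at_right (0::real). False"
    by eventually_elim (use closure_subset in blast)
  thus False by simp
qed

definition outer_unit_normal :: "'a::euclidean_space set \<Rightarrow> 'a \<Rightarrow> 'a" where
  "outer_unit_normal \<Omega> x = (THE n. is_outer_unit_normal \<Omega> x n)"

text \<open>\<open>C\<^sup>1\<close> functions, bounded with bounded first derivatives, on a possibly lower-dimensional set
  such as a hypersurface. Differentiability is taken within \<open>S\<close>; on a submanifold only the
  tangential part of \<open>D\<close> is determined by \<open>f\<close>, and the condition amounts to \<open>f\<close> having a
  continuous, bounded tangential gradient.\<close>

definition C1_bounded_on :: "'b::euclidean_space set \<Rightarrow> ('b \<Rightarrow> real) \<Rightarrow> bool" where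
  "C1_bounded_on S f \<longleftrightarrow> bounded (f ` S) \<and>
     (\<exists>D. (\<forall>x\<in>S. (f has_derivative (\<lambda>h. D x \<bullet> h)) (at x within S)) \<and>
          continuous_on S D \<and> bounded (D ` S))"

text \<open>\<open>u\<close> is of class \<open>C\<^sup>2\<^sup>,\<^sup>1\<close> on \<open>closure \<Omega> \<times> (0,T)\<close>, with time derivative \<open>ut\<close>, spatial
  gradient \<open>Du\<close> and spatial Hessian \<open>D2u\<close> (as a linear map). Spatial derivatives at boundary points
  are one-sided, i.e. taken within \<open>closure \<Omega>\<close>; if \<open>\<Omega>\<close> has \<open>C\<^sup>2\<close> boundary they are unique.\<close>

definition C21_derivatives ::
  "'a::euclidean_space set \<Rightarrow> ereal \<Rightarrow> ('a \<Rightarrow> real \<Rightarrow> real) \<Rightarrow>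
   ('a \<Rightarrow> real \<Rightarrow> real) \<Rightarrow> ('a \<Rightarrow> real \<Rightarrow> 'a) \<Rightarrow> ('a \<Rightarrow> real \<Rightarrow> 'a \<Rightarrow> 'a) \<Rightarrow> bool" where
  "C21_derivatives \<Omega> T u ut Du D2u \<longleftrightarrow>
     (let I = {t. 0 < t \<and> ereal t < T} in
       (\<forall>x\<in>closure \<Omega>. \<forall>t\<in>I.
          ((\<lambda>s. u x s) has_real_derivative ut x t) (at t) \<and>
          ((\<lambda>y. u y t) has_derivative (\<lambda>h. Du x t \<bullet> h)) (at x within closure \<Omega>) \<and>
          ((\<lambda>y. Du y t) has_derivative D2u x t) (at x within closure \<Omega>)) \<and>
       continuous_on (closure \<Omega> \<times> I) (\<lambda>(x, t). ut x t) \<and>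
       continuous_on (closure \<Omega> \<times> I) (\<lambda>(x, t). Du x t) \<and>
       (\<forall>k. continuous_on (closure \<Omega> \<times> I) (\<lambda>(x, t). D2u x t k)))"

text \<open>The trace \<open>\<Sum>i\<in>Basis. D2u x t i \<bullet> i\<close> of the Hessian is the Laplacian and
  \<open>Du x t \<bullet> outer_unit_normal \<Omega> x\<close> is the outer normal derivative.\<close>

definition classical_solution ::
  "'a::euclidean_space set \<Rightarrow> real \<Rightarrow> (real \<Rightarrow> 'a) \<Rightarrow> ('a \<Rightarrow> real \<Rightarrow> real) \<Rightarrow> ('a \<Rightarrow> real) \<Rightarrow>
   ereal \<Rightarrow> ('a \<Rightarrow> real \<Rightarrow> real) \<Rightarrow> bool" where
  "classical_solution \<Omega> p g \<sigma> u0 T u \<longleftrightarrow>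
     continuous_on (closure \<Omega> \<times> {t. 0 \<le> t \<and> ereal t < T}) (\<lambda>(x, t). u x t) \<and>
     (\<forall>x\<in>closure \<Omega>. u x 0 = u0 x) \<and>
     (\<exists>ut Du D2u. C21_derivatives \<Omega> T u ut Du D2u \<and>
        (\<forall>x\<in>closure \<Omega>. \<forall>t. 0 < t \<and> ereal t < T \<longrightarrow>
           ut x t = (\<Sum>i\<in>Basis. D2u x t i \<bullet> i) - g (u x t) \<bullet> Du x t + u x t powr p) \<and>
        (\<forall>x\<in>frontier \<Omega>. \<forall>t. 0 < t \<and> ereal t < T \<longrightarrow>
           \<sigma> x t * ut x t + Du x t \<bullet> outer_unit_normal \<Omega> x = 0))"

text \<open>The infimum is \<open>\<infinity>\<close> if there is no blow-up. The restriction \<open>s \<le> T\<close> is there because \<open>u\<close> is a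
  total function whose values beyond its time interval \<open>[0,T)\<close> are meaningless.\<close>

definition blow_up_time ::
  "'a::euclidean_space set \<Rightarrow> ereal \<Rightarrow> ('a \<Rightarrow> real \<Rightarrow> real) \<Rightarrow> ereal" where
  "blow_up_time \<Omega> T u =
     Inf {ereal s | s. 0 < s \<and> ereal s \<le> T \<and>
            filterlim (\<lambda>t. SUP x\<in>closure \<Omega>. \<bar>u x t\<bar>) at_top (at_left s)}"

text \<open>\<open>u\<close> cannot be continued to a larger time interval, and its maximal existence time \<open>T\<close> is the
  blow-up time in the supremum norm.\<close>

definition maximal_classical_solution ::
  "'a::euclidean_space set \<Rightarrow> real \<Rightarrow> (real \<Rightarrow> 'a) \<Rightarrow> ('a \<Rightarrow> real \<Rightarrow> real) \<Rightarrow> ('a \<Rightarrow> real) \<Rightarrow>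
   ereal \<Rightarrow> ('a \<Rightarrow> real \<Rightarrow> real) \<Rightarrow> bool" where
  "maximal_classical_solution \<Omega> p g \<sigma> u0 T u \<longleftrightarrow>
     0 < T \<and> classical_solution \<Omega> p g \<sigma> u0 T u \<and>
     \<not> (\<exists>T' v. T < T' \<and> classical_solution \<Omega> p g \<sigma> u0 T' v \<and>
           (\<forall>x\<in>closure \<Omega>. \<forall>t. 0 \<le> t \<and> ereal t < T \<longrightarrow> v x t = u x t)) \<and>
     T = blow_up_time \<Omega> T u"

end

theory Submission
  imports Defs
begin

text \<open>Suppose the solution is global. Let \<open>\<phi>\<close> be a \<open>C\<^sup>2\<close> function with \<open>\<partial>\<^sub>\<nu> \<phi> \<le> -1\<close> on the boundary and
  \<open>\<sigma> \<le> S\<close>. For small \<open>\<epsilon>\<close> the slowly rising function \<open>w = m/2 + \<epsilon> (t - 1 + (S + 1) \<phi>)\<close>, where \<open>m\<close> is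
  the minimum of \<open>u\<close> at time 1, stays below \<open>u\<close> as long as it takes values in a fixed bounded range: at
  a first touching point inside the domain the reaction term \<open>u\<^sup>p\<close> dominates, and at one on
  the boundary \<open>\<partial>\<^sub>t u \<le> \<epsilon>\<close> gives \<open>\<partial>\<^sub>\<nu> u \<ge> - S \<epsilon>\<close>, whereas touching forces \<open>\<partial>\<^sub>\<nu> u \<le> - (S + 1) \<epsilon>\<close>. Hence
  \<open>u\<close> exceeds any given level everywhere at some time.

  On the other hand, let \<open>\<zeta>\<close> be a high power of a bump supported in a ball inside the domain.
  Integrating by parts against \<open>\<zeta>\<close> moves all derivatives, including the one on \<open>G(u)\<close>, to \<open>\<zeta>\<close>, and since
  \<open>q < p\<close> the resulting terms are absorbed by \<open>\<integral> u\<^sup>p \<zeta>\<close>. With Jensen's inequality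
  \<open>M = \<integral> u \<zeta>\<close> satisfies \<open>M' \<ge> \<alpha> M\<^sup>p - C\<close>, which is impossible for all times once \<open>M\<close> has become large.\<close>

section \<open>A barrier for the normal derivative\<close>

text \<open>\<open>C2_function\<close> with its gradient and Hessian exposed, so that their formulas
  can be followed through sums, products and compositions.\<close>

definition C2_derivs :: "('a::euclidean_space \<Rightarrow> real) \<Rightarrow> ('a \<Rightarrow> 'a) \<Rightarrow> ('a \<Rightarrow> 'a \<Rightarrow> 'a) \<Rightarrow> bool" where
  "C2_derivs f D H \<longleftrightarrow>
     (\<forall>x. (f has_derivative (\<lambda>h. D x \<bullet> h)) (at x)) \<and>
     (\<forall>x. (D has_derivative H x) (at x)) \<and>
     (\<forall>k. continuous_on UNIV (\<lambda>x. H x k))"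

lemma C2_function_iff_derivs: "C2_function f \<longleftrightarrow> (\<exists>D H. C2_derivs f D H)"
  by (simp add: C2_function_def C2_derivs_def)

lemma C2_derivsD:
  assumes "C2_derivs f D H"
  shows "(f has_derivative (\<lambda>h. D x \<bullet> h)) (at x within S)" "(D has_derivative H x) (at x within S)"
    "continuous_on S (\<lambda>x. H x k)" "continuous_on S f" "continuous_on S D"
proof -
  have 1: "(f has_derivative (\<lambda>h. D x \<bullet> h)) (at x)" "(D has_derivative H x) (at x)" for x
    using assms by (auto simp: C2_derivs_def)
  then show "(f has_derivative (\<lambda>h. D x \<bullet> h)) (at x within S)" "(D has_derivative H x) (at x within S)"
    by (auto intro: has_derivative_at_withinI)
  show "continuous_on S (\<lambda>x. H x k)"
    using assms by (auto simp: C2_derivs_def intro: continuous_on_subset)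
  show "continuous_on S f" "continuous_on S D"
    using 1 by (meson continuous_at_imp_continuous_on has_derivative_continuous)+
qed

lemma C2_derivs_const: "C2_derivs (\<lambda>x. c) (\<lambda>x. 0) (\<lambda>x h. 0)"
  by (simp add: C2_derivs_def)

lemma C2_derivs_inner: "C2_derivs (\<lambda>x. x \<bullet> e) (\<lambda>x. e) (\<lambda>x h. 0)"
  unfolding C2_derivs_def
  by (auto intro!: derivative_eq_intros simp: inner_commute)

lemma C2_derivs_add:
  assumes "C2_derivs f D H" "C2_derivs f' D' H'"
  shows "C2_derivs (\<lambda>x. f x + f' x) (\<lambda>x. D x + D' x) (\<lambda>x h. H x h + H' x h)"
  unfolding C2_derivs_def
  by (auto intro!: derivative_eq_intros continuous_intros C2_derivsD[OF assms(1)] C2_derivsD[OF assms(2)]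
      simp: inner_add_left)

lemma C2_derivs_mult:
  assumes "C2_derivs f D H" "C2_derivs f' D' H'"
  shows "C2_derivs (\<lambda>x. f x * f' x) (\<lambda>x. f x *\<^sub>R D' x + f' x *\<^sub>R D x)
    (\<lambda>x h. (D x \<bullet> h) *\<^sub>R D' x + f x *\<^sub>R H' x h + ((D' x \<bullet> h) *\<^sub>R D x + f' x *\<^sub>R H x h))"
  unfolding C2_derivs_def
  by (auto intro!: derivative_eq_intros continuous_intros C2_derivsD[OF assms(1)] C2_derivsD[OF assms(2)]
      simp: inner_add_left algebra_simps)

lemma C2_derivs_cmult:
  assumes "C2_derivs f D H"
  shows "C2_derivs (\<lambda>x. c * f x) (\<lambda>x. c *\<^sub>R D x) (\<lambda>x h. c *\<^sub>R H x h)"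
  using C2_derivs_mult[OF C2_derivs_const[of c] assms] by simp

text \<open>Self-adjointness of \<open>P\<close> moves it from the increment to the gradient, which
  keeps the derivative in the form of an inner product. It is applied to the orthogonal projection
  occurring in \<open>C2_boundary\<close>.\<close>

lemma C2_derivs_comp_projection:
  fixes P :: "'a::euclidean_space \<Rightarrow> 'a"
  assumes f: "C2_derivs f D H" and P: "bounded_linear P" and adj: "\<And>x y. P x \<bullet> y = x \<bullet> P y"
  shows "C2_derivs (\<lambda>x. f (P x)) (\<lambda>x. P (D (P x))) (\<lambda>x h. P (H (P x) (P h)))"
  unfolding C2_derivs_def
proof (intro conjI allI)
  have PD: "(P has_derivative P) (at x)" for x
    by (rule bounded_linear_imp_has_derivative[OF P])
  have Pc: "continuous_on UNIV P"
    by (simp add: P linear_continuous_on)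
  show "((\<lambda>x. f (P x)) has_derivative (\<lambda>h. P (D (P x)) \<bullet> h)) (at x)" for x
    using has_derivative_compose[OF PD C2_derivsD(1)[OF f]] by (simp add: adj)
  show "((\<lambda>x. P (D (P x))) has_derivative (\<lambda>h. P (H (P x) (P h)))) (at x)" for x
    using bounded_linear.has_derivative[OF P has_derivative_compose[OF PD C2_derivsD(2)[OF f]]] .
  show "continuous_on UNIV (\<lambda>x. P (H (P x) (P k)))" for k
    by (intro bounded_linear.continuous_on[OF P]
        continuous_on_compose2[OF C2_derivsD(3)[OF f] Pc]) auto
qed

text \<open>Away from 0 the function is locally a power or zero. At the kink the exponent, being at
  least 2, bounds the difference quotient by \<open>\<bar>h\<bar> ^ (n + 1)\<close>, which tends to
  0.\<close>

lemma has_real_derivative_max_0_power: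
  "((\<lambda>y::real. max 0 y ^ (n + 2)) has_real_derivative real (n + 2) * max 0 y ^ (n + 1)) (at y)"
proof -
  consider "y > 0" | "y < 0" | "y = 0" by linarith
  then show ?thesis
  proof cases
    case 1
    have "((\<lambda>y::real. y ^ (n + 2)) has_real_derivative real (n + 2) * max 0 y ^ (n + 1)) (at y)"
      using DERIV_pow[of "n + 2" y] 1 by simp
    then show ?thesis
      by (rule has_field_derivative_transform_within_open[of _ _ _ "{0<..}"]) (use 1 in auto)
  next
    case 2
    have "((\<lambda>y::real. 0) has_real_derivative real (n + 2) * max 0 y ^ (n + 1)) (at y)"
      using 2 by auto
    then show ?thesis
      by (rule has_field_derivative_transform_within_open[of _ _ _ "{..<0}"]) (use 2 in auto)
  next
    case 3
    have "((\<lambda>h::real. max 0 h ^ (n + 2) / h) \<longlongrightarrow> 0) (at 0)"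
    proof (rule Lim_null_comparison)
      have "norm (max 0 h ^ (n + 2) / h) \<le> \<bar>h\<bar> ^ (n + 1)" for h :: real
      proof (cases "h > 0")
        case False
        then have "max 0 h ^ (n + 2) = 0" by simp
        then show ?thesis using zero_le_power_abs[of h "n + 1"] by (simp only: div_0 norm_zero)
      qed (simp add: max_def)
      then show "\<forall>\<^sub>F h in at 0. norm (max 0 h ^ (n + 2) / h) \<le> \<bar>h::real\<bar> ^ (n + 1)"
        by (intro always_eventually) auto
      show "((\<lambda>h::real. \<bar>h\<bar> ^ (n + 1)) \<longlongrightarrow> 0) (at 0)"
        by (auto intro!: tendsto_eq_intros)
    qed
    then show ?thesis using 3 by (simp add: DERIV_def)
  qed
qed

text \<open>The third power is the lowest integer power of the truncated quadratic with continuous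
  second derivatives. The boundary barrier uses \<open>n = 0\<close>; the test function for the mass
  needs a large \<open>n\<close>.\<close>

lemma C2_derivs_cutoff:
  fixes z :: "'a::euclidean_space"
  assumes P_def: "P = (\<lambda>x. max 0 (\<rho> - (x - z) \<bullet> (x - z)))"
  shows "C2_derivs (\<lambda>x. P x ^ (n + 3)) (\<lambda>x. (- 2 * real (n + 3) * P x ^ (n + 2)) *\<^sub>R (x - z))
    (\<lambda>x h. (4 * real (n + 3) * real (n + 2) * P x ^ (n + 1) * ((x - z) \<bullet> h)) *\<^sub>R (x - z)
       + (- 2 * real (n + 3) * P x ^ (n + 2)) *\<^sub>R h)"
proof -
  have d: "((\<lambda>x. P x ^ (k + 2)) has_derivative
      (\<lambda>h. (- 2 * real (k + 2) * P x ^ (k + 1)) * ((x - z) \<bullet> h))) (at x)" for k x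
  proof -
    have "((\<lambda>x. \<rho> - (x - z) \<bullet> (x - z)) has_derivative (\<lambda>h. - 2 * ((x - z) \<bullet> h))) (at x)"
      by (auto intro!: derivative_eq_intros simp: inner_commute)
    from has_derivative_compose[OF this has_real_derivative_max_0_power[of k, unfolded has_field_derivative_def]]
    show ?thesis unfolding P_def by (simp add: algebra_simps)
  qed
  have c: "continuous_on UNIV P" unfolding P_def by (intro continuous_intros)
  show ?thesis
    unfolding C2_derivs_def
  proof (intro conjI allI)
    show "((\<lambda>x. P x ^ (n + 3)) has_derivative (\<lambda>h. (- 2 * real (n + 3) * P x ^ (n + 2)) *\<^sub>R (x - z) \<bullet> h)) (at x)" for x
      using d[of "n+1" x] by (simp add: numeral_3_eq_3)
    show "((\<lambda>x. (- 2 * real (n + 3) * P x ^ (n + 2)) *\<^sub>R (x - z)) has_derivative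
        (\<lambda>h. (4 * real (n + 3) * real (n + 2) * P x ^ (n + 1) * ((x - z) \<bullet> h)) *\<^sub>R (x - z)
       + (- 2 * real (n + 3) * P x ^ (n + 2)) *\<^sub>R h)) (at x)" for x
      by (rule derivative_eq_intros d[of n x] refl)+
         (auto simp: algebra_simps)
    show "continuous_on UNIV (\<lambda>x. (4 * real (n + 3) * real (n + 2) * P x ^ (n + 1) * ((x - z) \<bullet> k)) *\<^sub>R (x - z)
       + (- 2 * real (n + 3) * P x ^ (n + 2)) *\<^sub>R k)" for k
      by (intro continuous_intros c)
  qed
qed

text \<open>Along the ray from \<open>x\<close> in direction \<open>h\<close> the derivative of
  \<open>\<rho>\<close> at 0 is \<open>D x \<bullet> h\<close>, so its sign decides which side of
  the level set the ray enters. Hence the normalized gradient meets the definition of the outer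
  normal.\<close>

lemma level_set_outer_normal:
  fixes \<rho> :: "'a::euclidean_space \<Rightarrow> real"
  assumes op: "open \<Omega>" and eq: "\<Omega> \<inter> ball z r = {x \<in> ball z r. \<rho> x < 0}"
    and d: "\<And>x. (\<rho> has_derivative (\<lambda>h. D x \<bullet> h)) (at x)"
    and x: "x \<in> frontier \<Omega>" "x \<in> ball z r" and D0: "D x \<noteq> 0"
  shows "\<rho> x = 0" and "outer_unit_normal \<Omega> x = (1 / norm (D x)) *\<^sub>R D x"
    and "is_outer_unit_normal \<Omega> x (outer_unit_normal \<Omega> x)"
proof -
  have c: "continuous_on UNIV \<rho>"
    by (intro continuous_at_imp_continuous_on ballI has_derivative_continuous[OF d])
  have mem: "w \<in> \<Omega> \<longleftrightarrow> \<rho> w < 0" if "w \<in> ball z r" for w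
    using eq that by blast
  \<comment> \<open>The part of the ball where \<open>\<rho>\<close> is positive is open and misses
    \<open>\<Omega>\<close>, so it misses the closure as well.\<close>
  have pos: "y \<notin> closure \<Omega>" if "y \<in> ball z r" "\<rho> y > 0" for y
  proof -
    define U where "U = ball z r \<inter> \<rho> -` {0<..}"
    have "open U" unfolding U_def
      by (intro open_Int open_ball open_vimage[OF _ c]) auto
    moreover have "U \<inter> \<Omega> = {}" using mem by (force simp: U_def)
    ultimately have "U \<inter> closure \<Omega> = {}" using open_Int_closure_eq_empty by blast
    then show ?thesis using that by (auto simp: U_def)
  qed
  have "x \<notin> \<Omega>" "x \<in> closure \<Omega>" using x op by (auto simp: frontier_def interior_open)
  then have "\<not> \<rho> x > 0" "\<not> \<rho> x < 0" using pos[OF x(2)] mem[OF x(2)] by blast+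
  then show rx: "\<rho> x = 0" by linarith
  define n where "n = (1 / norm (D x)) *\<^sub>R D x"
  have sgn: "h \<bullet> n = (D x \<bullet> h) / norm (D x)" for h by (simp add: n_def inner_commute)
  have line: "((\<lambda>s. \<rho> (x + s *\<^sub>R h)) has_real_derivative D x \<bullet> h) (at 0)" for h
  proof -
    have "((\<lambda>s::real. x + s *\<^sub>R h) has_derivative (\<lambda>s. s *\<^sub>R h)) (at 0)"
      by (auto intro!: derivative_eq_intros)
    from has_derivative_compose[OF this, of \<rho> "\<lambda>k. D x \<bullet> k"] d[of x]
    show ?thesis by (simp add: has_field_derivative_def mult_commute_abs)
  qed
  have near: "\<forall>\<^sub>F s in at_right 0. x + s *\<^sub>R h \<in> ball z r" for h
  proof -
    have "((\<lambda>s::real. x + s *\<^sub>R h) \<longlongrightarrow> x + 0 *\<^sub>R h) (at_right 0)"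
      by (intro tendsto_intros)
    then show ?thesis by (intro topological_tendstoD[of _ x]) (use x in auto)
  qed
  have "is_outer_unit_normal \<Omega> x n"
    unfolding is_outer_unit_normal_def
  proof (intro conjI allI impI)
    show "norm n = 1" using D0 by (simp add: n_def)
    fix h
    { assume "h \<bullet> n < 0"
      then have "D x \<bullet> h < 0" using D0 by (simp add: sgn divide_less_0_iff)
      from has_real_derivative_neg_dec_right[OF line this]
      obtain d where "d > 0" "\<forall>s>0. s < d \<longrightarrow> \<rho> (x + s *\<^sub>R h) < 0" using rx by auto
      then have "\<forall>\<^sub>F s in at_right 0. \<rho> (x + s *\<^sub>R h) < 0"
        by (auto simp: eventually_at_right_field)
      with near[of h] show "\<forall>\<^sub>F s in at_right 0. x + s *\<^sub>R h \<in> \<Omega>"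
        by eventually_elim (use mem in blast) }
    { assume "h \<bullet> n > 0"
      then have "D x \<bullet> h > 0" using D0 by (simp add: sgn zero_less_divide_iff)
      from has_real_derivative_pos_inc_right[OF line this]
      obtain d where "d > 0" "\<forall>s>0. s < d \<longrightarrow> \<rho> (x + s *\<^sub>R h) > 0" using rx by auto
      then have "\<forall>\<^sub>F s in at_right 0. \<rho> (x + s *\<^sub>R h) > 0"
        by (auto simp: eventually_at_right_field)
      with near[of h] show "\<forall>\<^sub>F s in at_right 0. x + s *\<^sub>R h \<notin> closure \<Omega>"
        by eventually_elim (use pos in blast) }
  qed
  moreover from this have "outer_unit_normal \<Omega> x = n"
    unfolding outer_unit_normal_def
    by (intro the_equality) (auto intro: is_outer_unit_normal_unique)
  ultimately show "outer_unit_normal \<Omega> x = (1 / norm (D x)) *\<^sub>R D x"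
    "is_outer_unit_normal \<Omega> x (outer_unit_normal \<Omega> x)" by (auto simp: n_def)
qed

text \<open>The graph function minus the height, \<open>\<gamma> (P x) - x \<bullet> e\<close>, has
  a gradient whose component along \<open>e\<close> is -1, because \<open>P\<close> annihilates
  \<open>e\<close>. By Cauchy-Schwarz the gradient has norm at least 1 everywhere.\<close>

lemma C2_boundary_local_defining_function:
  assumes "C2_boundary \<Omega>" "z \<in> frontier \<Omega>"
  obtains r \<rho> D H where "r > 0" "C2_derivs \<rho> D H" "\<And>x. norm (D x) \<ge> 1"
    "\<Omega> \<inter> ball z r = {x \<in> ball z r. \<rho> x < 0}"
proof -
  obtain r e \<gamma> where r: "r > 0" "norm e = 1" "C2_function \<gamma>"
     "\<Omega> \<inter> ball z r = {x \<in> ball z r. \<gamma> (x - (x \<bullet> e) *\<^sub>R e) < x \<bullet> e}"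
    using bspec[OF assms(1)[unfolded C2_boundary_def] assms(2)] by (elim exE conjE)
  from r(3) obtain D H where \<gamma>: "C2_derivs \<gamma> D H" by (auto simp: C2_function_iff_derivs)
  define P where "P = (\<lambda>x. x - (x \<bullet> e) *\<^sub>R e)"
  have P: "bounded_linear P"
    unfolding P_def by (intro bounded_linear_intros)
  have adj: "P x \<bullet> y = x \<bullet> P y" for x y
    by (simp add: P_def inner_diff_left inner_diff_right inner_commute)
  have ee: "e \<bullet> e = 1" using r by (simp add: norm_eq_1)
  have Pe: "P e = 0" by (simp add: P_def ee)
  note C = C2_derivs_add[OF C2_derivs_comp_projection[OF \<gamma> P adj] C2_derivs_cmult[OF C2_derivs_inner, of "-1" e]]
  show ?thesis
  proof (rule that[OF r(1) C])
    fix x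
    have "P (D (P x)) \<bullet> e = 0" by (simp add: adj Pe)
    then have "\<bar>(P (D (P x)) + - 1 *\<^sub>R e) \<bullet> e\<bar> = 1" by (simp add: inner_diff_left ee)
    then show "1 \<le> norm (P (D (P x)) + - 1 *\<^sub>R e)"
      using Cauchy_Schwarz_ineq2[of "P (D (P x)) + - 1 *\<^sub>R e" e] r(2) by simp
  qed (use r(4) in \<open>auto simp: P_def\<close>)
qed

text \<open>The gradient of a cutoff times a defining function is normal on the boundary, because the defining
  function vanishes there; so no tangential terms appear and the local pieces can simply be added.\<close>

lemma local_boundary_barrier:
  assumes op: "open \<Omega>" and C2: "C2_boundary \<Omega>" and z: "z \<in> frontier \<Omega>"
  obtains r \<phi> D H where "r > 0" "C2_derivs \<phi> D H"
    "\<And>x. x \<in> frontier \<Omega> \<Longrightarrow> D x \<bullet> outer_unit_normal \<Omega> x \<le> 0"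
    "\<And>x. x \<in> frontier \<Omega> \<Longrightarrow> x \<in> ball z r \<Longrightarrow> D x \<bullet> outer_unit_normal \<Omega> x \<le> -1"
    "is_outer_unit_normal \<Omega> z (outer_unit_normal \<Omega> z)"
proof -
  obtain r \<rho> D H where r: "r > 0" "C2_derivs \<rho> D H" "\<And>x. norm (D x) \<ge> 1"
    "\<Omega> \<inter> ball z r = {x \<in> ball z r. \<rho> x < 0}"
    by (rule C2_boundary_local_defining_function[OF C2 z], rule that)
  define P where "P = (\<lambda>x. max 0 (r\<^sup>2 - (x - z) \<bullet> (x - z)))"
  note cut = C2_derivs_cutoff[OF P_def, of 0]
  \<comment> \<open>On the ball of radius \<open>r / 2\<close> the base \<open>P\<close> of the
    cutoff is at least \<open>3 * r\<^sup>2 / 4\<close>; dividing by \<open>\<delta>\<close>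
    therefore makes the slope at most -1 there.\<close>
  define \<delta> where "\<delta> = (3 * r\<^sup>2 / 4) ^ 3"
  have \<delta>: "\<delta> > 0" using r(1) by (simp add: \<delta>_def)
  \<comment> \<open>The minus sign is needed because the gradient of \<open>\<rho>\<close> points
    outward on the boundary.\<close>
  obtain D' H' where C: "C2_derivs (\<lambda>x. - (1 / \<delta>) * (P x ^ (0 + 3) * \<rho> x)) D' H'"
    and D': "\<And>x. D' x = (- (1 / \<delta>)) *\<^sub>R
      (P x ^ (0 + 3) *\<^sub>R D x + \<rho> x *\<^sub>R ((- 2 * real (0 + 3) * P x ^ (0 + 2)) *\<^sub>R (x - z)))"
    by (rule that[OF C2_derivs_cmult[OF C2_derivs_mult[OF cut r(2)], of "- (1 / \<delta>)"] refl])
  have inside: "D' x \<bullet> outer_unit_normal \<Omega> x \<le> - (P x ^ 3 / \<delta>)"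
      "is_outer_unit_normal \<Omega> x (outer_unit_normal \<Omega> x)"
    if "x \<in> frontier \<Omega>" "x \<in> ball z r" for x
  proof -
    have "D x \<noteq> 0" using r(3)[of x] by auto
    note n = level_set_outer_normal[OF op r(4) C2_derivsD(1)[OF r(2)] that this]
    show "is_outer_unit_normal \<Omega> x (outer_unit_normal \<Omega> x)" by (fact n(3))
    have "D' x \<bullet> outer_unit_normal \<Omega> x = - (P x ^ 3 / \<delta>) * norm (D x)"
      using n(1,2) \<open>D x \<noteq> 0\<close> by (simp add: D' dot_square_norm power2_eq_square)
    also have "\<dots> \<le> - (P x ^ 3 / \<delta>)"
      using mult_left_mono[OF r(3)[of x], of "P x ^ 3 / \<delta>"] \<delta> by (simp add: P_def)
    finally show "D' x \<bullet> outer_unit_normal \<Omega> x \<le> - (P x ^ 3 / \<delta>)" .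
  qed
  have P0: "P x \<ge> 0" for x by (simp add: P_def)
  have dist: "(x - z) \<bullet> (x - z) = (dist z x)\<^sup>2" for x
    by (metis dist_commute dist_norm dot_square_norm)
  show ?thesis
  proof (rule that[of "r / 2", OF _ C])
    show "D' x \<bullet> outer_unit_normal \<Omega> x \<le> 0" if "x \<in> frontier \<Omega>" for x
    proof (cases "x \<in> ball z r")
      case True
      moreover have "P x ^ 3 / \<delta> \<ge> 0" using P0 \<delta> by simp
      ultimately show ?thesis using inside(1)[OF that] by linarith
    next
      case False
      then have "P x = 0" using r(1) by (simp add: P_def dist max_def power_mono not_less)
      then show ?thesis by (simp add: D')
    qed
    show "D' x \<bullet> outer_unit_normal \<Omega> x \<le> -1" if "x \<in> frontier \<Omega>" "x \<in> ball z (r / 2)" for x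
    proof -
      have "(dist z x)\<^sup>2 \<le> (r / 2)\<^sup>2" using that by (intro power_mono) auto
      moreover have "r\<^sup>2 - (dist z x)\<^sup>2 \<le> P x" by (simp add: P_def dist)
      ultimately have "3 * r\<^sup>2 / 4 \<le> P x" by (simp add: power_divide)
      then have "\<delta> \<le> P x ^ 3" unfolding \<delta>_def by (intro power_mono) auto
      then have "1 \<le> P x ^ 3 / \<delta>" using \<delta> by simp
      then show ?thesis using inside(1)[OF that(1)] that(2) r(1) by fastforce
    qed
    show "is_outer_unit_normal \<Omega> z (outer_unit_normal \<Omega> z)"
      using inside(2)[OF z] r(1) by simp
  qed (use r(1) in auto)
qed

text \<open>By compactness finitely many local barriers suffice, and they are added. Each has a
  nonpositive normal derivative on the whole frontier, so no summand spoils the bound -1 that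
  another one provides.\<close>

lemma boundary_barrier:
  assumes op: "open \<Omega>" and bd: "bounded \<Omega>" and C2: "C2_boundary \<Omega>"
  obtains \<phi> D H where "C2_derivs \<phi> D H"
    "\<And>x. x \<in> frontier \<Omega> \<Longrightarrow> D x \<bullet> outer_unit_normal \<Omega> x \<le> -1"
proof -
  define good where "good = (\<lambda>D. \<forall>x\<in>frontier \<Omega>. D x \<bullet> outer_unit_normal \<Omega> x \<le> 0)"
  define strict where "strict = (\<lambda>D U. \<forall>x\<in>frontier \<Omega> \<inter> U. D x \<bullet> outer_unit_normal \<Omega> x \<le> -1)"
  define \<U> where "\<U> = {U. open U \<and> (\<exists>\<phi> D H. C2_derivs \<phi> D H \<and> good D \<and> strict D U)}"
  have "compact (frontier \<Omega>)" using bd by (simp add: compact_frontier_bounded)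
  moreover have "frontier \<Omega> \<subseteq> \<Union>\<U>"
  proof
    fix z assume z: "z \<in> frontier \<Omega>"
    obtain r \<phi> D H where *: "r > 0" "C2_derivs \<phi> D H"
      "\<And>x. x \<in> frontier \<Omega> \<Longrightarrow> D x \<bullet> outer_unit_normal \<Omega> x \<le> 0"
      "\<And>x. x \<in> frontier \<Omega> \<Longrightarrow> x \<in> ball z r \<Longrightarrow> D x \<bullet> outer_unit_normal \<Omega> x \<le> -1"
      by (rule local_boundary_barrier[OF op C2 z], rule that)
    then have "good D" "strict D (ball z r)" by (auto simp: good_def strict_def)
    then have "ball z r \<in> \<U>" using *(2) unfolding \<U>_def by blast
    then show "z \<in> \<Union>\<U>" using *(1) by (intro UnionI[of "ball z r"]) simp_all
  qed
  ultimately obtain \<F> where \<F>: "\<F> \<subseteq> \<U>" "finite \<F>" "frontier \<Omega> \<subseteq> \<Union>\<F>"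
    by (rule compactE) (auto simp: \<U>_def)
  from \<F>(2,1) have "\<exists>\<phi> D H. C2_derivs \<phi> D H \<and> good D \<and> strict D (\<Union>\<F>)"
  proof (induction rule: finite_induct)
    case empty
    then show ?case using C2_derivs_const[of 0] by (auto simp: good_def strict_def intro!: exI)
  next
    case (insert U \<F>)
    then obtain \<phi> D H \<phi>' D' H' where *: "C2_derivs \<phi> D H" "good D" "strict D U"
        "C2_derivs \<phi>' D' H'" "good D'" "strict D' (\<Union>\<F>)"
      by (auto simp: \<U>_def)
    have "good (\<lambda>x. D x + D' x)" using *(2,5) by (fastforce simp: good_def inner_add_left)
    moreover have "strict (\<lambda>x. D x + D' x) (\<Union>(insert U \<F>))"
      unfolding strict_def
    proof
      fix x assume x: "x \<in> frontier \<Omega> \<inter> \<Union>(insert U \<F>)"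
      let ?n = "outer_unit_normal \<Omega> x"
      have "D x \<bullet> ?n \<le> 0" "D' x \<bullet> ?n \<le> 0" using * x by (auto simp: good_def)
      moreover have "D x \<bullet> ?n \<le> -1 \<or> D' x \<bullet> ?n \<le> -1" using * x by (auto simp: strict_def)
      ultimately show "(D x + D' x) \<bullet> ?n \<le> -1" by (auto simp: inner_add_left)
    qed
    ultimately show ?case using C2_derivs_add[OF *(1,4)] by blast
  qed
  then show ?thesis using that \<F>(3) unfolding strict_def by blast
qed

section \<open>Comparison with a rising subsolution\<close>

text \<open>The set \<open>Z\<close> where \<open>v\<close> is nonpositive is compact, and a point
  of it with least time is taken. Before that time \<open>v\<close> is positive, so at that time it
  is nonnegative by continuity and the value at the point is exactly 0.\<close>

lemma first_touching_point:
  fixes v :: "'a::euclidean_space \<Rightarrow> real \<Rightarrow> real"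
  assumes K: "compact K" and cont: "continuous_on (K \<times> {a..b}) (\<lambda>(x, t). v x t)"
    and init: "\<And>x. x \<in> K \<Longrightarrow> 0 < v x a"
    and neg: "x1 \<in> K" "t1 \<in> {a..b}" "v x1 t1 \<le> 0"
  obtains x t where "x \<in> K" "a < t" "t \<le> b" "v x t = 0" "\<And>y. y \<in> K \<Longrightarrow> 0 \<le> v y t"
    "\<And>y s. y \<in> K \<Longrightarrow> a \<le> s \<Longrightarrow> s < t \<Longrightarrow> 0 < v y s"
proof -
  define Z where "Z = (K \<times> {a..b}) \<inter> (\<lambda>(x, t). v x t) -` {..0}"
  have "closed Z" unfolding Z_def
    by (rule continuous_closed_preimage[OF cont]) (simp_all add: K compact_imp_closed closed_Times)
  moreover have "compact (K \<times> {a..b})" by (simp add: K compact_Times)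
  ultimately have "compact Z" unfolding Z_def
    by (metis Int_absorb2 Int_lower1 compact_Int_closed inf_commute)
  moreover have "(x1, t1) \<in> Z" using neg by (simp add: Z_def)
  then have "Z \<noteq> {}" by blast
  ultimately obtain q where q: "q \<in> Z" "\<And>q'. q' \<in> Z \<Longrightarrow> snd q \<le> snd q'"
    using continuous_attains_inf[of Z snd, OF _ _ continuous_on_snd[OF continuous_on_id]] by blast
  obtain x t where [simp]: "q = (x, t)" by (cases q)
  have x: "x \<in> K" "a \<le> t" "t \<le> b" "v x t \<le> 0" using q(1) by (auto simp: Z_def)
  with init[of x] have at: "a < t" by (cases "a = t") auto
  have before: "0 < v y s" if "y \<in> K" "a \<le> s" "s < t" for y s
  proof (rule ccontr)
    assume "\<not> 0 < v y s"
    then have "(y, s) \<in> Z" using that x by (auto simp: Z_def)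
    from q(2)[OF this] that show False by simp
  qed
  have nonneg: "0 \<le> v y t" if y: "y \<in> K" for y
  proof -
    have "continuous_on {a..t} (\<lambda>s. (\<lambda>(x, t). v x t) (y, s))"
      by (rule continuous_on_compose2[OF cont]) (use y x in \<open>auto intro!: continuous_intros\<close>)
    then have "continuous_on (closure {a..<t}) (v y)" using at by simp
    then show ?thesis
      by (rule continuous_ge_on_closure) (use at before[OF y] in \<open>auto intro: less_imp_le\<close>)
  qed
  show ?thesis
    using that[of x t] x at before nonneg nonneg[of x] by force
qed

text \<open>If \<open>H e \<bullet> e\<close> were negative, the slope of \<open>v\<close> along
  \<open>e\<close>, which is 0 at \<open>x\<close>, would be negative just after \<open>x\<close>,
  and the mean value theorem would produce a value below the minimum. Only the derivative of
  \<open>D\<close> at the single point \<open>x\<close> enters.\<close>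

lemma interior_min_derivatives:
  fixes v :: "'a::euclidean_space \<Rightarrow> real"
  assumes op: "open \<Omega>" and x: "x \<in> \<Omega>" and min: "\<And>y. y \<in> \<Omega> \<Longrightarrow> v x \<le> v y"
    and d1: "\<And>y. y \<in> \<Omega> \<Longrightarrow> (v has_derivative (\<lambda>h. D y \<bullet> h)) (at y)"
    and d2: "(D has_derivative H) (at x)"
  shows "D x = 0" and "0 \<le> H e \<bullet> e"
proof -
  have "(\<lambda>h. D x \<bullet> h) = (\<lambda>h. 0)"
    by (rule differential_zero_maxmin[OF x op d1[OF x]]) (use min in auto)
  from fun_cong[OF this, of "D x"] show D0: "D x = 0" by simp
  show "0 \<le> H e \<bullet> e"
  proof (rule ccontr)
    assume neg: "\<not> 0 \<le> H e \<bullet> e"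
    have line: "((\<lambda>s::real. x + s *\<^sub>R e) has_derivative (\<lambda>s. s *\<^sub>R e)) (at s)" for s
      by (auto intro!: derivative_eq_intros)
    have "((\<lambda>s. D (x + s *\<^sub>R e)) has_derivative (\<lambda>s. H (s *\<^sub>R e))) (at 0)"
      using has_derivative_compose[OF line[of 0], of D H] d2 by simp
    then have "((\<lambda>s. D (x + s *\<^sub>R e) \<bullet> e) has_derivative (\<lambda>s. H (s *\<^sub>R e) \<bullet> e)) (at 0)"
      by (rule has_derivative_inner_left)
    moreover have "(\<lambda>s. H (s *\<^sub>R e) \<bullet> e) = (*) (H e \<bullet> e)"
      using has_derivative_linear[OF d2] by (auto simp: linear_scale fun_eq_iff)
    ultimately have "((\<lambda>s. D (x + s *\<^sub>R e) \<bullet> e) has_real_derivative H e \<bullet> e) (at 0)"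
      by (simp add: has_field_derivative_def)
    from has_real_derivative_neg_dec_right[OF this] neg D0
    obtain d where d: "d > 0" "\<And>s. 0 < s \<Longrightarrow> s < d \<Longrightarrow> D (x + s *\<^sub>R e) \<bullet> e < 0" by auto
    obtain \<rho> where \<rho>: "\<rho> > 0" "ball x \<rho> \<subseteq> \<Omega>" using op x by (meson openE)
    \<comment> \<open>The summand 1 keeps the divisor positive whatever \<open>e\<close> is. The
      length \<open>\<sigma>\<close> below keeps the segment inside the ball and inside the range
      where the slope is negative.\<close>
    define N where "N = norm e + 1"
    have N: "N > 0" "norm e \<le> N" by (simp_all add: N_def add_nonneg_pos)
    define \<sigma> where "\<sigma> = min (d / 2) (\<rho> / N / 2)"
    have pos: "0 < \<sigma>" using d \<rho> N by (simp add: \<sigma>_def)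
    have in\<Omega>: "x + s *\<^sub>R e \<in> \<Omega>" if "0 \<le> s" "s \<le> \<sigma>" for s
    proof -
      have "s * norm e \<le> \<sigma> * N" using that pos N by (intro mult_mono) auto
      also have "\<dots> \<le> \<rho> / N / 2 * N"
        using N by (intro mult_right_mono) (auto simp: \<sigma>_def)
      also have "\<dots> = \<rho> / 2" using N by simp
      also have "\<dots> < \<rho>" using \<rho> by simp
      finally show ?thesis using \<rho>(2) that(1) by (auto simp: dist_norm)
    qed
    have dv: "((\<lambda>s. v (x + s *\<^sub>R e)) has_real_derivative D (x + s *\<^sub>R e) \<bullet> e) (at s)"
      if "0 \<le> s" "s \<le> \<sigma>" for s
      using has_derivative_compose[OF line d1[OF in\<Omega>[OF that]]]
      by (simp add: has_field_derivative_def mult_commute_abs)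
    obtain \<xi> where \<xi>: "0 < \<xi>" "\<xi> < \<sigma>" "v (x + \<sigma> *\<^sub>R e) - v (x + 0 *\<^sub>R e) = (\<sigma> - 0) * (D (x + \<xi> *\<^sub>R e) \<bullet> e)"
      using MVT2[OF pos dv] by auto
    have "D (x + \<xi> *\<^sub>R e) \<bullet> e < 0" using \<xi> d by (simp add: \<sigma>_def)
    then have "\<sigma> * (D (x + \<xi> *\<^sub>R e) \<bullet> e) < 0" using pos by (simp add: mult_pos_neg)
    then show False using \<xi>(3) min[OF in\<Omega>[of \<sigma>]] pos by simp
  qed
qed

text \<open>Small steps along \<open>- n\<close> lead into \<open>\<Omega>\<close>. If
  \<open>D \<bullet> n\<close> were positive, \<open>v\<close> would drop below its minimum along
  them.\<close>

lemma boundary_min_normal_derivative: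
  fixes v :: "'a::euclidean_space \<Rightarrow> real"
  assumes n: "is_outer_unit_normal \<Omega> x n" and min: "\<And>y. y \<in> closure \<Omega> \<Longrightarrow> v x \<le> v y"
    and d: "(v has_derivative (\<lambda>h. D \<bullet> h)) (at x within closure \<Omega>)"
  shows "D \<bullet> n \<le> 0"
proof (rule ccontr)
  assume pos: "\<not> D \<bullet> n \<le> 0"
  \<comment> \<open>Since \<open>v\<close> is differentiable only within the closure, the parameter
    of the line is restricted to the values that stay there.\<close>
  define S where "S = {s::real. x + s *\<^sub>R (- n) \<in> closure \<Omega>}"
  have "((\<lambda>s::real. x + s *\<^sub>R (- n)) has_derivative (\<lambda>s. s *\<^sub>R (- n))) (at 0 within S)"
    by (auto intro!: derivative_eq_intros)
  moreover have "(v has_derivative (\<lambda>h. D \<bullet> h)) (at (x + 0 *\<^sub>R (- n)) within (\<lambda>s. x + s *\<^sub>R (- n)) ` S)"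
    using has_derivative_subset[OF d, of "(\<lambda>s. x + s *\<^sub>R (- n)) ` S"] by (auto simp: S_def)
  ultimately have "((\<lambda>s. v (x + s *\<^sub>R (- n))) has_derivative (\<lambda>s. D \<bullet> (s *\<^sub>R (- n)))) (at 0 within S)"
    by (rule has_derivative_in_compose)
  then have "((\<lambda>s. v (x + s *\<^sub>R (- n))) has_real_derivative - (D \<bullet> n)) (at 0 within S)"
    unfolding has_field_derivative_def by (rule has_derivative_eq_rhs) (auto simp: fun_eq_iff)
  from has_real_derivative_neg_dec_right[OF this] pos
  obtain d where d: "d > 0" "\<And>s. 0 < s \<Longrightarrow> s \<in> S \<Longrightarrow> s < d \<Longrightarrow> v (x + s *\<^sub>R (- n)) < v x"
    by auto
  have "n \<bullet> n = 1" using n by (simp add: is_outer_unit_normal_def norm_eq_1)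
  then have "(- n) \<bullet> n < 0" by simp
  then have "\<forall>\<^sub>F s in at_right 0. x + s *\<^sub>R (- n) \<in> \<Omega>"
    using n unfolding is_outer_unit_normal_def by blast
  moreover have "\<forall>\<^sub>F s in at_right 0. s \<in> {0<..<d}"
    using d(1) by (rule eventually_at_right_real)
  ultimately have "\<forall>\<^sub>F s in at_right 0. x + s *\<^sub>R (- n) \<in> \<Omega> \<and> s \<in> {0<..<d}"
    by (rule eventually_conj)
  then obtain s where s: "x + s *\<^sub>R (- n) \<in> \<Omega>" "0 < s" "s < d"
    using eventually_happens'[OF trivial_limit_at_right_real] by fastforce
  then have "x + s *\<^sub>R (- n) \<in> closure \<Omega>" using closure_subset by blast
  then show False using d(2)[of s] min[of "x + s *\<^sub>R (- n)"] s by (simp add: S_def)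
qed

lemma compact_continuous_bound:
  fixes f :: "'a::topological_space \<Rightarrow> 'b::real_normed_vector"
  assumes "compact K" "continuous_on K f"
  obtains B where "B \<ge> 0" "\<And>x. x \<in> K \<Longrightarrow> norm (f x) \<le> B"
proof -
  have "bounded (f ` K)" using assms by (simp add: compact_continuous_image compact_imp_bounded)
  then obtain B where "\<And>x. x \<in> K \<Longrightarrow> norm (f x) \<le> B" by (auto simp: bounded_iff)
  then have "norm (f x) \<le> max 0 B" if "x \<in> K" for x using that by fastforce
  then show ?thesis by (intro that[of "max 0 B"]) auto
qed

text \<open>The situation obtained by supposing that the maximal time is infinite, with the
  derivatives of \<open>u\<close> as fixed functions. The boundary condition enters as a hypothesis
  of \<open>exceeds_any_level\<close>.\<close>

locale global_positive_solution =
  fixes \<Omega> :: "'a::euclidean_space set" and p :: real and g :: "real \<Rightarrow> 'a"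
    and u ut :: "'a \<Rightarrow> real \<Rightarrow> real" and Du :: "'a \<Rightarrow> real \<Rightarrow> 'a" and D2u :: "'a \<Rightarrow> real \<Rightarrow> 'a \<Rightarrow> 'a"
  assumes op: "open \<Omega>" and bd: "bounded \<Omega>" and ne: "\<Omega> \<noteq> {}"
    and p1: "p > 1" and cont_g: "continuous_on UNIV g"
    and deriv_t: "\<And>x t. x \<in> closure \<Omega> \<Longrightarrow> 0 < t \<Longrightarrow> ((\<lambda>s. u x s) has_real_derivative ut x t) (at t)"
    and deriv_x: "\<And>x t. x \<in> closure \<Omega> \<Longrightarrow> 0 < t \<Longrightarrow>
      ((\<lambda>y. u y t) has_derivative (\<lambda>h. Du x t \<bullet> h)) (at x within closure \<Omega>)"
    and deriv_xx: "\<And>x t. x \<in> closure \<Omega> \<Longrightarrow> 0 < t \<Longrightarrow>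
      ((\<lambda>y. Du y t) has_derivative D2u x t) (at x within closure \<Omega>)"
    and cont_u: "continuous_on (closure \<Omega> \<times> {0<..}) (\<lambda>(x, t). u x t)"
    and cont_ut: "continuous_on (closure \<Omega> \<times> {0<..}) (\<lambda>(x, t). ut x t)"
    and cont_Du: "continuous_on (closure \<Omega> \<times> {0<..}) (\<lambda>(x, t). Du x t)"
    and cont_D2u: "\<And>k. continuous_on (closure \<Omega> \<times> {0<..}) (\<lambda>(x, t). D2u x t k)"
    and pde: "\<And>x t. x \<in> closure \<Omega> \<Longrightarrow> 0 < t \<Longrightarrow>
      ut x t = (\<Sum>i\<in>Basis. D2u x t i \<bullet> i) - g (u x t) \<bullet> Du x t + u x t powr p"
    and pos: "\<And>x t. x \<in> closure \<Omega> \<Longrightarrow> 0 < t \<Longrightarrow> 0 < u x t"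
begin

lemma compact_closure: "compact (closure \<Omega>)"
  using bd by (simp add: compact_closure)

lemma at_within_closure: "x \<in> \<Omega> \<Longrightarrow> at x within closure \<Omega> = at x"
  using op by (meson at_within_open_subset closure_subset)

text \<open>The constants are chosen in an order that avoids circularity: \<open>L\<close> fixes the
  range of \<open>w\<close> and so the bound \<open>\<Gamma>\<close>, these fix the slope
  \<open>\<epsilon>\<close>, and only then comes the final time \<open>\<tau>\<close>. The
  comparison starts at time 1, where the minimum of \<open>u\<close> is positive, whereas the
  initial datum may vanish somewhere.\<close>

lemma exceeds_any_level:
  assumes \<phi>: "C2_derivs \<phi> D H"
    and \<phi>n: "\<And>x. x \<in> frontier \<Omega> \<Longrightarrow> D x \<bullet> outer_unit_normal \<Omega> x \<le> -1"
    and n: "\<And>x. x \<in> frontier \<Omega> \<Longrightarrow> is_outer_unit_normal \<Omega> x (outer_unit_normal \<Omega> x)"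
    and bc: "\<And>x t. x \<in> frontier \<Omega> \<Longrightarrow> 0 < t \<Longrightarrow> \<sigma> x t * ut x t + Du x t \<bullet> outer_unit_normal \<Omega> x = 0"
    and \<sigma>: "\<And>x t. x \<in> frontier \<Omega> \<Longrightarrow> 0 < t \<Longrightarrow> 0 \<le> \<sigma> x t" "\<And>x t. x \<in> frontier \<Omega> \<Longrightarrow> 0 < t \<Longrightarrow> \<sigma> x t \<le> S"
    and S: "0 \<le> S" and L: "0 < L"
  obtains t where "t > 0" "\<And>x. x \<in> closure \<Omega> \<Longrightarrow> L \<le> u x t"
proof -
  \<comment> \<open>At a boundary touching point the boundary condition gives a normal derivative of
    at least \<open>- S * \<epsilon>\<close>. The factor \<open>S + 1\<close> leaves a surplus
    \<open>\<epsilon>\<close> for the contradiction.\<close>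
  define \<psi> D\<psi> H\<psi> where "\<psi> = (\<lambda>x. (S + 1) * \<phi> x)" and "D\<psi> = (\<lambda>x. (S + 1) *\<^sub>R D x)"
    and "H\<psi> = (\<lambda>x h. (S + 1) *\<^sub>R H x h)"
  have \<psi>: "C2_derivs \<psi> D\<psi> H\<psi>"
    unfolding \<psi>_def D\<psi>_def H\<psi>_def by (rule C2_derivs_cmult[OF \<phi>])
  obtain K1 where K1: "K1 \<ge> 0" "\<And>x. x \<in> closure \<Omega> \<Longrightarrow> norm (\<psi> x) \<le> K1"
    by (rule compact_continuous_bound[OF compact_closure C2_derivsD(4)[OF \<psi>]], rule that)
  obtain K2 where K2: "K2 \<ge> 0" "\<And>x. x \<in> closure \<Omega> \<Longrightarrow> norm (D\<psi> x) \<le> K2"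
    by (rule compact_continuous_bound[OF compact_closure C2_derivsD(5)[OF \<psi>]], rule that)
  have lap_cont: "continuous_on (closure \<Omega>) (\<lambda>x. \<Sum>i\<in>Basis. H\<psi> x i \<bullet> i)"
    by (intro continuous_intros C2_derivsD(3)[OF \<psi>])
  obtain K3 where K3: "K3 \<ge> 0" "\<And>x. x \<in> closure \<Omega> \<Longrightarrow> norm (\<Sum>i\<in>Basis. H\<psi> x i \<bullet> i) \<le> K3"
    by (rule compact_continuous_bound[OF compact_closure lap_cont], rule that)
  define K where "K = K1 + K2 + K3"
  have K: "K \<ge> 0" using K1 K2 K3 by (simp add: K_def)
  have K\<psi>: "\<bar>\<psi> x\<bar> \<le> K" "norm (D\<psi> x) \<le> K" "- K \<le> (\<Sum>i\<in>Basis. H\<psi> x i \<bullet> i)"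
    if "x \<in> closure \<Omega>" for x
    using K1(1) K2(1) K3(1) K1(2)[OF that] K2(2)[OF that] K3(2)[OF that] by (auto simp: K_def)
  have "continuous_on (closure \<Omega>) (\<lambda>x. (\<lambda>(x, t). u x t) (x, 1))"
    by (rule continuous_on_compose2[OF cont_u]) (auto intro!: continuous_intros)
  then obtain x0 where x0: "x0 \<in> closure \<Omega>" "\<And>x. x \<in> closure \<Omega> \<Longrightarrow> u x0 1 \<le> u x 1"
    using continuous_attains_inf[OF compact_closure, of "\<lambda>x. u x 1"] ne by auto
  define m where "m = u x0 1"
  have m: "m > 0" using pos[OF x0(1)] by (simp add: m_def)
  \<comment> \<open>The subsolution \<open>w\<close> will stay in \<open>{m / 4..m + L}\<close> up
    to time \<open>\<tau>\<close>, and \<open>g\<close> matters only where \<open>u\<close> equals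
    \<open>w\<close>.\<close>
  have cg: "continuous_on {0..m + L} g" using cont_g by (rule continuous_on_subset) simp
  obtain \<Gamma> where \<Gamma>: "\<Gamma> \<ge> 0" "\<And>\<omega>. \<omega> \<in> {0..m + L} \<Longrightarrow> norm (g \<omega>) \<le> \<Gamma>"
    by (rule compact_continuous_bound[OF compact_Icc cg], rule that)
  \<comment> \<open>\<open>R\<close> ensures \<open>\<epsilon> * K \<le> m / 4\<close>, so that
    \<open>w\<close> starts below \<open>u\<close> and stays above \<open>m / 4\<close>.
    \<open>Q\<close> collects the terms at an interior touching point: the time slope 1, the
    Laplacian \<open>K\<close> and the drift \<open>\<Gamma> * K\<close>, each times
    \<open>\<epsilon>\<close>. The halving in \<open>\<epsilon>\<close> makes the comparison with
    the reaction term strict.\<close>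
  define R where "R = K + 1"
  have R: "R > 0" using K by (simp add: R_def)
  define Q where "Q = 1 + K + \<Gamma> * K"
  have Q: "Q > 0" using K \<Gamma> by (simp add: Q_def add_pos_nonneg)
  define \<epsilon> where "\<epsilon> = min (m / 4 / R) ((m / 4) powr p / 2 / Q)"
  have \<epsilon>: "\<epsilon> > 0" using m R Q by (simp add: \<epsilon>_def)
  have "\<epsilon> * R \<le> m / 4 / R * R"
    using R by (intro mult_right_mono) (auto simp: \<epsilon>_def)
  then have "\<epsilon> * R \<le> m / 4" using R by simp
  then have \<epsilon>K: "\<epsilon> * K \<le> m / 4" using \<epsilon> by (simp add: R_def algebra_simps)
  have "\<epsilon> * Q \<le> (m / 4) powr p / 2 / Q * Q"
    using Q by (intro mult_right_mono) (auto simp: \<epsilon>_def)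
  also have "\<dots> < (m / 4) powr p" using Q m by simp
  finally have \<epsilon>Q: "\<epsilon> * Q < (m / 4) powr p" .
  \<comment> \<open>At this time the rise \<open>\<epsilon> * (\<tau> - 1)\<close> equals
    \<open>L + \<epsilon> * K\<close>, enough to reach \<open>L\<close> wherever
    \<open>\<psi>\<close> is most negative.\<close>
  define \<tau> where "\<tau> = 1 + L / \<epsilon> + K"
  have \<tau>: "\<tau> > 1" using L \<epsilon> K by (simp add: \<tau>_def add_pos_nonneg)
  define w where "w = (\<lambda>x t. m / 2 + \<epsilon> * (t - 1 + \<psi> x))"
  have \<epsilon>\<psi>K: "\<bar>\<epsilon> * \<psi> x\<bar> \<le> \<epsilon> * K" if "x \<in> closure \<Omega>" for x
    unfolding abs_mult using \<epsilon> K\<psi>(1)[OF that] by (intro mult_mono) auto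
  have \<epsilon>\<psi>: "\<bar>\<epsilon> * \<psi> x\<bar> \<le> m / 4" if "x \<in> closure \<Omega>" for x
    using \<epsilon>\<psi>K[OF that] \<epsilon>K by linarith
  have w: "m / 4 \<le> w x t" "w x t \<le> m + L" if "x \<in> closure \<Omega>" "1 \<le> t" "t \<le> \<tau>" for x t
  proof -
    have "0 \<le> \<epsilon> * (t - 1)" using that \<epsilon> by simp
    then show "m / 4 \<le> w x t" using \<epsilon>\<psi>[OF that(1)] unfolding w_def distrib_left by linarith
    have "\<epsilon> * (t - 1) \<le> \<epsilon> * (L / \<epsilon> + K)"
      using that \<epsilon> by (intro mult_left_mono) (auto simp: \<tau>_def)
    also have "\<dots> = L + \<epsilon> * K" using \<epsilon> by (simp add: distrib_left)
    finally show "w x t \<le> m + L" using \<epsilon>\<psi>[OF that(1)] \<epsilon>K unfolding w_def distrib_left by linarith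
  qed
  define v where "v = (\<lambda>x t. u x t - w x t)"
  have cv: "continuous_on (closure \<Omega> \<times> {1..\<tau>}) (\<lambda>(x, t). v x t)"
  proof -
    have 1: "continuous_on (closure \<Omega> \<times> {1..\<tau>}) (\<lambda>(x, t). u x t)"
      by (rule continuous_on_subset[OF cont_u]) auto
    have 2: "continuous_on (closure \<Omega> \<times> {1..\<tau>}) (\<lambda>z. \<psi> (fst z))"
      by (rule continuous_on_compose2[OF C2_derivsD(4)[OF \<psi>, of UNIV]]) (auto intro!: continuous_intros)
    have "continuous_on (closure \<Omega> \<times> {1..\<tau>}) (\<lambda>z. (\<lambda>(x, t). u x t) z - (m / 2 + \<epsilon> * (snd z - 1 + \<psi> (fst z))))"
      by (intro continuous_intros 1 2)
    then show ?thesis by (simp add: v_def w_def case_prod_unfold)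
  qed
  have vinit: "0 < v x 1" if "x \<in> closure \<Omega>" for x
    using x0(2)[OF that] \<epsilon>\<psi>[OF that] m by (simp add: v_def w_def m_def)
  have vpos: "0 < v x1 t1" if hyp: "x1 \<in> closure \<Omega>" "t1 \<in> {1..\<tau>}" for x1 t1
  proof (rule ccontr)
    assume "\<not> 0 < v x1 t1"
    then have "v x1 t1 \<le> 0" by simp
    obtain x t where xt: "x \<in> closure \<Omega>" "1 < t" "t \<le> \<tau>" "v x t = 0"
      and nonneg: "\<And>y. y \<in> closure \<Omega> \<Longrightarrow> 0 \<le> v y t"
      and before: "\<And>y s. y \<in> closure \<Omega> \<Longrightarrow> 1 \<le> s \<Longrightarrow> s < t \<Longrightarrow> 0 < v y s"
      by (rule first_touching_point[OF compact_closure cv vinit hyp \<open>v x1 t1 \<le> 0\<close>], assumption) (rule that)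
    have t0: "0 < t" using xt by simp
    \<comment> \<open>Before time \<open>t\<close> the difference \<open>v\<close> is positive at
      \<open>x\<close>, and at \<open>t\<close> it is 0, so its time derivative cannot be
      positive.\<close>
    have ut: "ut x t \<le> \<epsilon>"
    proof (rule ccontr)
      assume "\<not> ut x t \<le> \<epsilon>"
      then have l: "0 < ut x t - \<epsilon>" by simp
      have "((\<lambda>s. v x s) has_real_derivative ut x t - \<epsilon>) (at t)"
        unfolding v_def w_def by (auto intro!: derivative_eq_intros deriv_t[OF xt(1) t0])
      from DERIV_pos_inc_left[OF this l] obtain d where
        d: "d > 0" "\<And>h. 0 < h \<Longrightarrow> h < d \<Longrightarrow> v x (t - h) < v x t" by auto
      define h where "h = min (d / 2) (t - 1)"
      have "0 < h" "h < d" "1 \<le> t - h" using d xt by (auto simp: h_def)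
      then show False using d(2)[of h] before[OF xt(1), of "t - h"] xt by simp
    qed
    have vx: "((\<lambda>y. v y t) has_derivative (\<lambda>h. (Du y t - \<epsilon> *\<^sub>R D\<psi> y) \<bullet> h)) (at y within closure \<Omega>)"
      if "y \<in> closure \<Omega>" for y
      unfolding v_def w_def
      by (rule derivative_eq_intros deriv_x[OF that t0] C2_derivsD(1)[OF \<psi>] refl)+
         (simp add: inner_diff_left)
    have vxx: "((\<lambda>y. Du y t - \<epsilon> *\<^sub>R D\<psi> y) has_derivative (\<lambda>h. D2u x t h - \<epsilon> *\<^sub>R H\<psi> x h)) (at x within closure \<Omega>)"
      by (rule derivative_eq_intros deriv_xx[OF xt(1) t0] C2_derivsD(2)[OF \<psi>] refl)+ simp
    show False
    proof (cases "x \<in> \<Omega>")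
      case False
      then have fr: "x \<in> frontier \<Omega>" using xt(1) op by (simp add: frontier_def interior_open)
      let ?n = "outer_unit_normal \<Omega> x"
      have "(Du x t - \<epsilon> *\<^sub>R D\<psi> x) \<bullet> ?n \<le> 0"
        by (rule boundary_min_normal_derivative[OF n[OF fr] _ vx[OF xt(1)]]) (use nonneg xt in auto)
      then have "Du x t \<bullet> ?n \<le> \<epsilon> * (S + 1) * (D x \<bullet> ?n)" by (simp add: inner_diff_left D\<psi>_def)
      also have "\<dots> \<le> \<epsilon> * (S + 1) * (-1)"
        using \<phi>n[OF fr] \<epsilon> S by (intro mult_left_mono) auto
      finally have "Du x t \<bullet> ?n \<le> - (\<epsilon> * S) - \<epsilon>" by (simp add: algebra_simps)
      moreover have "\<sigma> x t * ut x t \<le> S * \<epsilon>"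
      proof -
        have "\<sigma> x t * ut x t \<le> \<sigma> x t * \<epsilon>" using \<sigma>(1)[OF fr t0] ut by (intro mult_left_mono)
        also have "\<dots> \<le> S * \<epsilon>" using \<sigma>(2)[OF fr t0] \<epsilon> by simp
        finally show ?thesis .
      qed
      ultimately show False using bc[OF fr t0] \<epsilon> by (simp add: mult.commute)
    next
      case True
      have vx': "((\<lambda>y. v y t) has_derivative (\<lambda>h. (Du y t - \<epsilon> *\<^sub>R D\<psi> y) \<bullet> h)) (at y)" if "y \<in> \<Omega>" for y
        using vx[of y] that closure_subset[of \<Omega>] by (auto simp: at_within_closure)
      have vmin: "v x t \<le> v y t" if "y \<in> \<Omega>" for y
        using nonneg[of y] that closure_subset[of \<Omega>] xt by auto
      note mins = interior_min_derivatives[OF op True vmin vx' vxx[unfolded at_within_closure[OF True]]]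
      have Du: "Du x t = \<epsilon> *\<^sub>R D\<psi> x" using mins(1) by simp
      have "\<epsilon> * (- K) \<le> \<epsilon> * (\<Sum>i\<in>Basis. H\<psi> x i \<bullet> i)"
        using K\<psi>(3)[OF xt(1)] \<epsilon> by (intro mult_left_mono) auto
      also have "\<dots> = (\<Sum>i\<in>Basis. \<epsilon> *\<^sub>R H\<psi> x i \<bullet> i)" by (simp add: sum_distrib_left)
      also have "\<dots> \<le> (\<Sum>i\<in>Basis. D2u x t i \<bullet> i)"
        using mins(2) by (intro sum_mono) (simp add: inner_diff_left)
      finally have lap: "- (\<epsilon> * K) \<le> (\<Sum>i\<in>Basis. D2u x t i \<bullet> i)" by simp
      have uw: "u x t = w x t" using xt by (simp add: v_def)
      have ur: "m / 4 \<le> u x t" "u x t \<le> m + L" using w[OF xt(1)] xt uw by auto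
      have "\<bar>g (u x t) \<bullet> D\<psi> x\<bar> \<le> \<Gamma> * K"
        by (rule order_trans[OF Cauchy_Schwarz_ineq2])
           (use ur m \<Gamma> K\<psi>(2)[OF xt(1)] in \<open>auto intro!: mult_mono\<close>)
      then have "\<epsilon> * (g (u x t) \<bullet> D\<psi> x) \<le> \<epsilon> * (\<Gamma> * K)" using \<epsilon> by simp
      then have "g (u x t) \<bullet> Du x t \<le> \<epsilon> * (\<Gamma> * K)" by (simp add: Du)
      moreover have "(m / 4) powr p \<le> u x t powr p" using ur m p1 by (intro powr_mono2) auto
      \<comment> \<open>The equation at the touching point yields
        \<open>(m / 4) powr p \<le> \<epsilon> * Q\<close>, contrary to the choice of
        \<open>\<epsilon>\<close>.\<close>
      ultimately have "- (\<epsilon> * K) - \<epsilon> * (\<Gamma> * K) + (m / 4) powr p \<le> \<epsilon>"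
        using lap ut pde[OF xt(1) t0] by linarith
      then show False using \<epsilon>Q by (simp add: Q_def algebra_simps)
    qed
  qed
  show ?thesis
  proof (rule that[of \<tau>])
    show "\<tau> > 0" using \<tau> by simp
    fix x assume x: "x \<in> closure \<Omega>"
    have "\<epsilon> * (\<tau> - 1) = L + \<epsilon> * K" using \<epsilon> by (simp add: \<tau>_def distrib_left)
    then have "L \<le> w x \<tau>" using m \<epsilon>\<psi>K[OF x] unfolding w_def distrib_left by linarith
    then show "L \<le> u x \<tau>" using vpos[OF x, of \<tau>] \<tau> by (simp add: v_def)
  qed
qed

end

section \<open>The weighted mass\<close>

text \<open>The integral of \<open>f\<close> is invariant under translation along \<open>e\<close>; differentiate in the translation
  parameter.\<close>

lemma integral_directional_derivative_eq_0:
  fixes f :: "'a::euclidean_space \<Rightarrow> real"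
  assumes der: "\<And>x. (f has_derivative f' x) (at x)"
    and cont: "continuous_on UNIV (\<lambda>x. f' x e)"
    and supp: "\<And>x. x \<notin> cbox a b \<Longrightarrow> f x = 0"
  shows "integral (cbox a b) (\<lambda>x. f' x e) = 0"
proof -
  have fc: "continuous_on S f" for S
    using der by (meson continuous_at_imp_continuous_on has_derivative_continuous)
  have f'0: "f' x e = 0" if "x \<notin> cbox a b" for x
  proof -
    have "((\<lambda>_. 0) has_derivative f' x) (at x)"
      by (rule has_derivative_transform_within_open[OF der, where s = "- cbox a b"])
         (use that supp in \<open>auto simp: open_Compl closed_cbox\<close>)
    then have "f' x = (\<lambda>_. 0)" by (rule has_derivative_unique) simp
    then show ?thesis by simp
  qed
  obtain B where B: "\<And>x. x \<in> cbox a b \<Longrightarrow> norm x \<le> B"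
    using bounded_cbox[of a b] by (auto simp: bounded_iff)
  \<comment> \<open>One box containing the support of all translates with
    \<open>\<bar>s\<bar> \<le> 1\<close>: differentiation under the integral sign needs a fixed
    domain.\<close>
  obtain c where c: "cball (0::'a) (B + norm e) \<subseteq> cbox (- c) c"
    using bounded_subset_cbox_symmetric[OF bounded_cball] by blast
  have sub: "cbox (a - s *\<^sub>R e) (b - s *\<^sub>R e) \<subseteq> cbox (- c) c" if "\<bar>s\<bar> \<le> 1" for s
  proof
    fix x assume "x \<in> cbox (a - s *\<^sub>R e) (b - s *\<^sub>R e)"
    then have "x + s *\<^sub>R e \<in> cbox a b" by (auto simp: mem_box inner_add_left inner_diff_left algebra_simps)
    then have "norm (x + s *\<^sub>R e) \<le> B" by (rule B)
    moreover have "norm x \<le> norm (x + s *\<^sub>R e) + norm (s *\<^sub>R e)"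
      using norm_triangle_ineq4[of "x + s *\<^sub>R e" "s *\<^sub>R e"] by simp
    moreover have "norm (s *\<^sub>R e) \<le> norm e" using that by (simp add: mult_left_le_one_le)
    ultimately show "x \<in> cbox (- c) c" using c by (auto simp: subset_iff)
  qed
  define F where "F = (\<lambda>s. integral (cbox (- c) c) (\<lambda>x. f (x + s *\<^sub>R e)))"
  have F: "F s = integral (cbox a b) f" if "\<bar>s\<bar> \<le> 1" for s
  proof -
    have "(f has_integral integral (cbox a b) f) (cbox a b)"
      by (simp add: fc integrable_continuous integrable_integral)
    then have "((\<lambda>x. f (x + s *\<^sub>R e)) has_integral integral (cbox a b) f) (cbox (a - s *\<^sub>R e) (b - s *\<^sub>R e))"
      by (rule has_integral_shift_cbox)
    then have "((\<lambda>x. f (x + s *\<^sub>R e)) has_integral integral (cbox a b) f) (cbox (- c) c)"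
    proof (rule has_integral_on_superset)
      fix x assume "x \<notin> cbox (a - s *\<^sub>R e) (b - s *\<^sub>R e)"
      then have "x + s *\<^sub>R e \<notin> cbox a b" by (auto simp: mem_box inner_add_left inner_diff_left algebra_simps)
      then show "f (x + s *\<^sub>R e) = 0" by (rule supp)
    qed (rule sub[OF that])
    then show ?thesis unfolding F_def by (rule integral_unique)
  qed
  have "(F has_real_derivative integral (cbox (- c) c) (\<lambda>x. f' (x + 0 *\<^sub>R e) e)) (at 0 within {-1<..<1})"
    unfolding F_def
  proof (rule leibniz_rule_field_derivative)
    fix s x
    have "((\<lambda>s::real. x + s *\<^sub>R e) has_derivative (\<lambda>s. s *\<^sub>R e)) (at s)"
      by (auto intro!: derivative_eq_intros)
    from has_derivative_compose[OF this der]
    have "((\<lambda>s. f (x + s *\<^sub>R e)) has_derivative (\<lambda>h. f' (x + s *\<^sub>R e) (h *\<^sub>R e))) (at s)" .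
    moreover have "(\<lambda>h. f' (x + s *\<^sub>R e) (h *\<^sub>R e)) = (*) (f' (x + s *\<^sub>R e) e)"
      using has_derivative_linear[OF der] by (auto simp: linear_scale fun_eq_iff)
    ultimately show "((\<lambda>s. f (x + s *\<^sub>R e)) has_real_derivative f' (x + s *\<^sub>R e) e) (at s within {-1<..<1})"
      by (simp add: has_field_derivative_def has_derivative_at_withinI)
    show "(\<lambda>x. f (x + s *\<^sub>R e)) integrable_on cbox (- c) c"
      by (intro integrable_continuous continuous_on_compose2[OF fc[of UNIV]]) (auto intro!: continuous_intros)
  next
    have "continuous_on ({-1<..<1} \<times> cbox (- c) c) (\<lambda>z. f' (snd z + fst z *\<^sub>R e) e)"
      by (rule continuous_on_compose2[OF cont]) (auto intro!: continuous_intros)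
    then show "continuous_on ({-1<..<1} \<times> cbox (- c) c) (\<lambda>(s, x). f' (x + s *\<^sub>R e) e)"
      by (simp add: case_prod_unfold)
  qed auto
  then have "(F has_real_derivative integral (cbox (- c) c) (\<lambda>x. f' x e)) (at 0)"
    by (simp add: at_within_open[of _ "{-1<..<1}"])
  moreover have "(F has_real_derivative 0) (at 0)"
    by (rule has_field_derivative_transform_within_open[of "\<lambda>_. integral (cbox a b) f" _ _ "{-1<..<1}"])
       (auto simp: F)
  ultimately have "integral (cbox (- c) c) (\<lambda>x. f' x e) = 0"
    by (rule DERIV_unique)
  moreover have "((\<lambda>x. f' x e) has_integral integral (cbox a b) (\<lambda>x. f' x e)) (cbox (- c) c)"
  proof (rule has_integral_on_superset[of _ _ "cbox a b"])
    show "((\<lambda>x. f' x e) has_integral integral (cbox a b) (\<lambda>x. f' x e)) (cbox a b)"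
      by (intro integrable_integral integrable_continuous continuous_on_subset[OF cont]) auto
    show "cbox a b \<subseteq> cbox (- c) c" using sub[of 0] by simp
  qed (rule f'0)
  ultimately show ?thesis by (simp add: integral_unique)
qed

section \<open>The equation tested against a compactly supported weight\<close>

context global_positive_solution
begin

lemma continuous_on_closure_slice:
  assumes "continuous_on (closure \<Omega> \<times> {0<..}) (\<lambda>(x, t). f x t)" "S \<subseteq> closure \<Omega>" "0 < t"
  shows "continuous_on S (\<lambda>x. f x t)"
proof -
  have "continuous_on S (\<lambda>x. (\<lambda>(x, t). f x t) (x, t))"
    by (rule continuous_on_compose2[OF assms(1)]) (use assms in \<open>auto intro!: continuous_intros\<close>)
  then show ?thesis by simp
qed

text \<open>Each \<open>J i\<close> is the derivative in direction \<open>i\<close> of a function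
  supported in \<open>K\<close>: the mixed products of \<open>Du\<close> and \<open>Z\<close>
  cancel. So its integral vanishes. Summing over the basis is Green's identity together with the
  integration by parts of the drift through its primitive \<open>G\<close>.\<close>

lemma weak_formulation:
  assumes G: "\<And>\<omega>. (G has_vector_derivative g \<omega>) (at \<omega>)"
    and \<zeta>: "C2_derivs \<zeta> Z Y"
    and supp: "\<And>x. x \<notin> K \<Longrightarrow> \<zeta> x = 0" "\<And>x. x \<notin> K \<Longrightarrow> Z x = 0" "\<And>x. x \<notin> K \<Longrightarrow> Y x = (\<lambda>h. 0)"
    and K: "closed K" "K \<subseteq> cbox a b" "cbox a b \<subseteq> \<Omega>" and t: "0 < t"
  shows "integral (cbox a b) (\<lambda>x. \<zeta> x * ut x t) =
    integral (cbox a b) (\<lambda>x. \<zeta> x * u x t powr p + u x t * (\<Sum>i\<in>Basis. Y x i \<bullet> i) + Z x \<bullet> G (u x t))"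
proof -
  have \<Omega>c: "\<Omega> \<subseteq> closure \<Omega>" by (rule closure_subset)
  have bc: "cbox a b \<subseteq> closure \<Omega>" using K \<Omega>c by blast
  have Gc: "continuous_on UNIV G"
    using G by (meson continuous_at_imp_continuous_on has_vector_derivative_continuous)
  note cu = continuous_on_closure_slice[OF cont_u _ t]
  note cDu = continuous_on_closure_slice[OF cont_Du _ t]
  note cut = continuous_on_closure_slice[OF cont_ut _ t]
  have cD2u: "continuous_on S (\<lambda>x. D2u x t k)" if "S \<subseteq> closure \<Omega>" for S k
    using continuous_on_closure_slice[OF cont_D2u[of k] that t] .
  have cG: "continuous_on S (\<lambda>x. G (u x t))" if "S \<subseteq> closure \<Omega>" for S
    by (rule continuous_on_compose2[OF Gc cu[OF that]]) simp
  have cg: "continuous_on S (\<lambda>x. g (u x t))" if "S \<subseteq> closure \<Omega>" for S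
    by (rule continuous_on_compose2[OF cont_g cu[OF that]]) simp
  define J where "J = (\<lambda>i x. \<zeta> x * (D2u x t i \<bullet> i) - u x t * (Y x i \<bullet> i) - (Z x \<bullet> i) * (G (u x t) \<bullet> i)
      - \<zeta> x * ((Du x t \<bullet> i) * (g (u x t) \<bullet> i)))"
  have cJ: "continuous_on S (J i)" if "S \<subseteq> closure \<Omega>" for S i
    unfolding J_def
    by (intro continuous_intros C2_derivsD[OF \<zeta>] cu cDu cD2u cG cg that)
  have J0: "integral (cbox a b) (J i) = 0" for i
  proof -
    \<comment> \<open>Extension by zero is smooth enough because the open sets
      \<open>\<Omega>\<close> and \<open>- K\<close> cover the space and the expression vanishes on
      their overlap.\<close>
    define f where "f = (\<lambda>x. if x \<in> \<Omega> then \<zeta> x * (Du x t \<bullet> i) - u x t * (Z x \<bullet> i) - \<zeta> x * (G (u x t) \<bullet> i) else 0)"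
    define f' where "f' = (\<lambda>x h. if x \<in> \<Omega> then
        (\<zeta> x * (D2u x t h \<bullet> i) + (Z x \<bullet> h) * (Du x t \<bullet> i))
        - (u x t * (Y x h \<bullet> i) + (Du x t \<bullet> h) * (Z x \<bullet> i))
        - (\<zeta> x * ((Du x t \<bullet> h) * (g (u x t) \<bullet> i)) + (Z x \<bullet> h) * (G (u x t) \<bullet> i)) else 0)"
    have cover: "\<Omega> \<union> - K = UNIV" using K by blast
    have f0: "f x = 0" "f' x = (\<lambda>h. 0)" if "x \<notin> K" for x
      using supp[OF that] by (auto simp: f_def f'_def)
    have f'J: "f' x i = (if x \<in> \<Omega> then J i x else 0)" for x
      by (simp add: f'_def J_def algebra_simps)
    have "integral (cbox a b) (\<lambda>x. f' x i) = 0"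
    proof (rule integral_directional_derivative_eq_0)
      show "(f has_derivative f' x) (at x)" for x
      proof (cases "x \<in> \<Omega>")
        case True
        then have xc: "x \<in> closure \<Omega>" using \<Omega>c by blast
        note d1 = deriv_x[OF xc t, unfolded at_within_closure[OF True]]
        note d2 = deriv_xx[OF xc t, unfolded at_within_closure[OF True]]
        have dG: "((\<lambda>x. G (u x t)) has_derivative (\<lambda>h. (Du x t \<bullet> h) *\<^sub>R g (u x t))) (at x)"
          using has_derivative_compose[OF d1 G[unfolded has_vector_derivative_def]] .
        have "((\<lambda>x. \<zeta> x * (Du x t \<bullet> i) - u x t * (Z x \<bullet> i) - \<zeta> x * (G (u x t) \<bullet> i)) has_derivative f' x) (at x)"
          by (rule derivative_eq_intros d1 d2 dG C2_derivsD[OF \<zeta>] refl)+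
             (use True in \<open>auto simp: f'_def fun_eq_iff\<close>)
        then show ?thesis
          by (rule has_derivative_transform_within_open[OF _ op True]) (simp add: f_def)
      next
        case False
        then have "x \<in> - K" using K by blast
        have "((\<lambda>_. 0) has_derivative f' x) (at x)" using f0(2)[of x] \<open>x \<in> - K\<close> by simp
        then show ?thesis
          by (rule has_derivative_transform_within_open[where s = "- K"])
             (use K \<open>x \<in> - K\<close> f0 in auto)
      qed
      have "continuous_on \<Omega> (\<lambda>x. f' x i)"
        by (rule continuous_on_eq[OF cJ[OF \<Omega>c, of i]]) (simp add: f'J)
      moreover have "continuous_on (- K) (\<lambda>x. f' x i)"
        by (rule continuous_on_eq[of _ "\<lambda>_. 0"]) (auto simp: f0)
      ultimately have "continuous_on (\<Omega> \<union> - K) (\<lambda>x. f' x i)"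
        using op K by (intro continuous_on_open_Un) auto
      then show "continuous_on UNIV (\<lambda>x. f' x i)" by (simp only: cover)
      show "f x = 0" if "x \<notin> cbox a b" for x using f0 that K by blast
    qed
    moreover have "integral (cbox a b) (\<lambda>x. f' x i) = integral (cbox a b) (J i)"
      by (rule integral_cong) (use K in \<open>auto simp: f'J\<close>)
    ultimately show ?thesis by simp
  qed
  define R where "R = (\<lambda>x. \<zeta> x * u x t powr p + u x t * (\<Sum>i\<in>Basis. Y x i \<bullet> i) + Z x \<bullet> G (u x t))"
  have eq: "(\<Sum>i\<in>Basis. J i x) = \<zeta> x * ut x t - R x" if "x \<in> cbox a b" for x
  proof -
    have "(\<Sum>i\<in>Basis. J i x) = \<zeta> x * (\<Sum>i\<in>Basis. D2u x t i \<bullet> i) - u x t * (\<Sum>i\<in>Basis. Y x i \<bullet> i)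
        - Z x \<bullet> G (u x t) - \<zeta> x * (Du x t \<bullet> g (u x t))"
      unfolding J_def
      by (simp only: sum_subtractf sum_distrib_left[symmetric] euclidean_inner[symmetric])
    also have "\<dots> = \<zeta> x * ut x t - R x"
    proof -
      have "ut x t = (\<Sum>i\<in>Basis. D2u x t i \<bullet> i) - Du x t \<bullet> g (u x t) + u x t powr p"
        using pde[of x t] that bc t by (auto simp: inner_commute)
      then show ?thesis by (simp only: R_def) (simp add: distrib_left right_diff_distrib)
    qed
    finally show ?thesis .
  qed
  have cR: "continuous_on (cbox a b) R"
    unfolding R_def using pos[OF _ t] bc
    by (intro continuous_intros C2_derivsD[OF \<zeta>] cu cG bc continuous_on_powr') (auto simp: less_imp_le, metis less_irrefl subset_iff)
  have c1: "continuous_on (cbox a b) (\<lambda>x. \<zeta> x * ut x t)"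
    by (intro continuous_intros C2_derivsD[OF \<zeta>] cut bc)
  have "0 = (\<Sum>i\<in>Basis. integral (cbox a b) (J i))" by (simp add: J0)
  also have "\<dots> = integral (cbox a b) (\<lambda>x. \<Sum>i\<in>Basis. J i x)"
    by (intro integral_sum[symmetric] integrable_continuous cJ bc) simp
  also have "\<dots> = integral (cbox a b) (\<lambda>x. \<zeta> x * ut x t - R x)"
    by (rule integral_cong) (rule eq)
  also have "\<dots> = integral (cbox a b) (\<lambda>x. \<zeta> x * ut x t) - integral (cbox a b) R"
    by (intro integral_diff integrable_continuous c1 cR)
  finally show ?thesis by (simp add: R_def)
qed

lemma weighted_mass_derivative:
  assumes \<zeta>: "continuous_on UNIV \<zeta>" and sub: "cbox a b \<subseteq> \<Omega>" and t: "0 < t"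
  shows "((\<lambda>t. integral (cbox a b) (\<lambda>x. \<zeta> x * u x t)) has_real_derivative
    integral (cbox a b) (\<lambda>x. \<zeta> x * ut x t)) (at t)"
proof -
  have bc: "cbox a b \<subseteq> closure \<Omega>" using sub closure_subset by blast
  have "((\<lambda>t. integral (cbox a b) (\<lambda>x. \<zeta> x * u x t)) has_real_derivative
    integral (cbox a b) (\<lambda>x. \<zeta> x * ut x t)) (at t within {0<..})"
  proof (rule leibniz_rule_field_derivative)
    show "((\<lambda>t. \<zeta> x * u x t) has_real_derivative \<zeta> x * ut x t) (at t within {0<..})"
      if "t \<in> {0<..}" "x \<in> cbox a b" for t x
      using deriv_t[of x t] that bc
      by (auto intro!: DERIV_cmult intro: has_field_derivative_at_within)
    show "(\<lambda>x. \<zeta> x * u x t) integrable_on cbox a b" if "t \<in> {0<..}" for t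
      using that
      by (intro integrable_continuous continuous_intros continuous_on_subset[OF \<zeta>]
          continuous_on_closure_slice[OF cont_u bc]) auto
    have "continuous_on ({0<..} \<times> cbox a b) (\<lambda>z. \<zeta> (snd z) * (\<lambda>(x, t). ut x t) (snd z, fst z))"
      by (intro continuous_intros continuous_on_compose2[OF \<zeta>] continuous_on_compose2[OF cont_ut])
         (use bc in auto)
    then show "continuous_on ({0<..} \<times> cbox a b) (\<lambda>(t, x). \<zeta> x * ut x t)"
      by (simp add: case_prod_unfold)
  qed (use t in auto)
  then show ?thesis using t by (simp add: at_within_open[of _ "{0<..}"])
qed

end

section \<open>Estimates for the differential inequality of the mass\<close>

lemma powr_tangent_line:
  assumes "p > 1" "x > 0" "\<mu> > 0"
  shows "p * \<mu> powr (p - 1) * x - (p - 1) * \<mu> powr p \<le> x powr (p::real)"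
proof -
  \<comment> \<open>Young's inequality with the conjugate exponent, applied to \<open>x\<close> and
    \<open>\<mu> powr (p - 1)\<close>, is exactly the tangent line bound at
    \<open>\<mu>\<close>.\<close>
  define q where "q = p / (p - 1)"
  have q: "q > 1" "1 / p + 1 / q = 1" using assms(1) by (simp_all add: q_def field_simps)
  have "x * \<mu> powr (p - 1) \<le> x powr p / p + (\<mu> powr (p - 1)) powr q / q"
    using Youngs_inequality[OF assms(1) q, of x "\<mu> powr (p - 1)"] assms by simp
  also have "(\<mu> powr (p - 1)) powr q = \<mu> powr p" using assms by (simp add: powr_powr q_def)
  also have "\<mu> powr p / q = \<mu> powr p * (p - 1) / p" by (simp add: q_def)
  finally have "p * (x * \<mu> powr (p - 1)) \<le> p * (x powr p / p + \<mu> powr p * (p - 1) / p)"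
    using assms by simp
  also have "\<dots> = x powr p + \<mu> powr p * (p - 1)" using assms by (simp add: distrib_left)
  finally show ?thesis by (simp add: algebra_simps)
qed

text \<open>The initial bound persists, so the constant \<open>C\<close> costs at most half of the
  superlinear term. Then \<open>M powr (1 - p)\<close> decreases at least at the linear rate
  \<open>\<beta>\<close> and would have to become negative.\<close>

lemma superlinear_growth_impossible:
  fixes M M' :: "real \<Rightarrow> real"
  assumes p: "p > 1" and \<alpha>: "\<alpha> > 0" and C: "C > 0"
    and der: "\<And>t. t \<ge> a \<Longrightarrow> (M has_real_derivative M' t) (at t)"
    and pos: "\<And>t. t \<ge> a \<Longrightarrow> M t > 0"
    and ineq: "\<And>t. t \<ge> a \<Longrightarrow> M' t \<ge> \<alpha> * M t powr p - C"
    and init: "\<alpha> * M a powr p \<ge> 2 * C"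
  shows False
proof -
  have ge: "M a \<le> M s" if s: "a \<le> s" for s
  proof (rule ccontr)
    assume less: "\<not> M a \<le> M s"
    \<comment> \<open>At the last time in \<open>{a..s}\<close> with \<open>M\<close> at least
      \<open>M a\<close> the derivative is still positive, so \<open>M\<close> remains above
      \<open>M a\<close> a little longer.\<close>
    define Z where "Z = {a..s} \<inter> M -` {M a..}"
    have "continuous_on {a..s} M"
      using der by (intro DERIV_continuous_on) (auto intro: has_field_derivative_at_within)
    then have "closed Z" unfolding Z_def
      by (intro continuous_closed_preimage) auto
    moreover have "bounded Z"
      by (rule bounded_subset[OF bounded_closed_interval[of a s]]) (simp add: Z_def)
    ultimately have "compact Z" by (simp add: compact_eq_bounded_closed)
    moreover have "a \<in> Z" using s by (simp add: Z_def)
    then have "Z \<noteq> {}" by blast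
    ultimately obtain \<tau> where \<tau>: "\<tau> \<in> Z" "\<And>r. r \<in> Z \<Longrightarrow> r \<le> \<tau>"
      using continuous_attains_sup[of Z "\<lambda>x. x", OF _ _ continuous_on_id] by blast
    have \<tau>': "a \<le> \<tau>" "\<tau> \<le> s" "M a \<le> M \<tau>" using \<tau>(1) by (auto simp: Z_def)
    then have "\<tau> < s" using less by (cases "\<tau> = s") auto
    have "M a powr p \<le> M \<tau> powr p" using \<tau>' pos[of a] p by (intro powr_mono2) auto
    then have "\<alpha> * M a powr p \<le> \<alpha> * M \<tau> powr p" using \<alpha> by simp
    then have "0 < M' \<tau>" using ineq[OF \<tau>'(1)] init C by linarith
    from DERIV_pos_inc_right[OF der[OF \<tau>'(1)] this]
    obtain d where d: "d > 0" "\<And>h. 0 < h \<Longrightarrow> h < d \<Longrightarrow> M \<tau> < M (\<tau> + h)" by auto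
    define h where "h = min (d / 2) (s - \<tau>)"
    have h: "0 < h" "h < d" "\<tau> + h \<le> s" using d \<open>\<tau> < s\<close> by (auto simp: h_def)
    then have "\<tau> + h \<in> Z" using d(2)[of h] \<tau>' by (auto simp: Z_def)
    from \<tau>(2)[OF this] h show False by simp
  qed
  define \<beta> where "\<beta> = (p - 1) * (\<alpha> / 2)"
  have \<beta>: "\<beta> > 0" using p \<alpha> by (simp add: \<beta>_def)
  \<comment> \<open>\<open>N\<close> is nonincreasing because \<open>M' \<ge> (\<alpha> / 2) M\<^sup>p\<close>\<close>
  define N where "N = (\<lambda>t. M t powr (1 - p) + \<beta> * t)"
  have Nd: "\<exists>y. (N has_real_derivative y) (at t) \<and> y \<le> 0" if t: "a \<le> t" for t
  proof (intro exI conjI)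
    show "(N has_real_derivative (1 - p) * M t powr (1 - p - 1) * M' t + \<beta>) (at t)"
      unfolding N_def
      by (rule derivative_eq_intros DERIV_fun_powr[OF der[OF t] pos[OF t], of "1 - p"] refl)+ simp
    have "M a powr p \<le> M t powr p" using ge[OF t] pos[of a] p by (intro powr_mono2) auto
    then have "\<alpha> * M a powr p \<le> \<alpha> * M t powr p" using \<alpha> by simp
    then have M': "\<alpha> / 2 * M t powr p \<le> M' t" using ineq[OF t] init by simp
    have "\<alpha> / 2 = \<alpha> / 2 * (M t powr (- p) * M t powr p)"
      using pos[OF t] by (simp flip: powr_add)
    also have "\<dots> \<le> M t powr (- p) * M' t"
      using mult_left_mono[OF M', of "M t powr (- p)"] by (simp add: mult_ac)
    finally have "\<beta> \<le> (p - 1) * (M t powr (- p) * M' t)" 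
      unfolding \<beta>_def using p by (intro mult_left_mono) auto
    then show "(1 - p) * M t powr (1 - p - 1) * M' t + \<beta> \<le> 0" by (simp add: algebra_simps)
  qed
  \<comment> \<open>A time at which the linear part of \<open>N\<close> alone already exceeds
    \<open>N a\<close>.\<close>
  define s where "s = max a (N a / \<beta> + 1)"
  have "N s \<le> N a"
    by (rule DERIV_nonpos_imp_nonincreasing) (use Nd in \<open>auto simp: s_def\<close>)
  moreover have "N a < \<beta> * s"
  proof -
    have "N a = \<beta> * (N a / \<beta>)" using \<beta> by simp
    also have "\<dots> < \<beta> * s" using \<beta> by (intro mult_strict_left_mono) (auto simp: s_def)
    finally show ?thesis .
  qed
  moreover have "0 < M s powr (1 - p)" using pos[of s] by (simp add: s_def)
  ultimately show False by (simp add: N_def)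
qed

text \<open>The factor \<open>y\<^sup>2\<close> lost by differentiating the weight \<open>y ^ (k + 3)\<close> twice is recovered from
  the gap between the exponents \<open>s\<close> and \<open>p\<close>.\<close>

lemma weighted_absorption:
  fixes B s p :: real
  assumes s: "0 \<le> s" "s < p" and B: "0 < B" and k: "2 * s / (p - s) \<le> real (k + 1)"
  obtains C where "C > 0" "\<And>y w. 0 \<le> y \<Longrightarrow> y \<le> 1 \<Longrightarrow> 0 < w \<Longrightarrow>
    B * (1 + w powr s) * y ^ (k + 1) \<le> y ^ (k + 3) * w powr p / 2 + C"
proof (rule that[of "B + B * (2 * B) powr (s / (p - s))"])
  show "0 < B + B * (2 * B) powr (s / (p - s))" using B by (simp add: add_pos_nonneg)
  fix y w :: real
  assume y: "0 \<le> y" "y \<le> 1" and w: "0 < w"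
  have "B * y ^ (k + 1) \<le> B" using y B by (simp add: mult_le_cancel_left1 power_le_one del: power_Suc)
  \<comment> \<open>If \<open>w powr (p - s) * y\<^sup>2\<close> is at least \<open>2 * B\<close>,
    half of the leading term absorbs the left side. Otherwise \<open>w\<close> is bounded by a
    negative power of \<open>y\<close>, and the lower bound on \<open>k\<close> provides enough
    factors of \<open>y \<le> 1\<close> to compensate it.\<close>
  moreover have "B * (w powr s * y ^ (k + 1)) \<le> y ^ (k + 3) * w powr p / 2 + B * (2 * B) powr (s / (p - s))"
  proof (cases "2 * B \<le> w powr (p - s) * y\<^sup>2")
    case True
    have "B * (w powr s * y ^ (k + 1)) \<le> w powr (p - s) * y\<^sup>2 / 2 * (w powr s * y ^ (k + 1))"
      using True y by (intro mult_right_mono) auto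
    also have "\<dots> = y ^ (k + 3) * (w powr (p - s) * w powr s) / 2"
      by (simp add: power_add power2_eq_square power3_eq_cube)
    also have "w powr (p - s) * w powr s = w powr p" by (simp flip: powr_add)
    finally show ?thesis using B by (simp add: add_increasing2)
  next
    case False
    have "w powr s * y ^ (k + 1) \<le> (2 * B) powr (s / (p - s))"
    proof (cases "y = 0")
      case True
      then show ?thesis by simp
    next
      case False
      with y have y0: "0 < y" by simp
      have "y ^ (k + 1) = y powr real (k + 1)" using y0 by (simp only: powr_realpow)
      also have "\<dots> \<le> y powr (2 * (s / (p - s)))" using k y y0 by (intro powr_mono') auto
      also have "\<dots> = (y\<^sup>2) powr (s / (p - s))" using y0 by (simp add: powr_powr flip: powr_numeral)
      finally have "w powr s * y ^ (k + 1) \<le> (w powr (p - s)) powr (s / (p - s)) * (y\<^sup>2) powr (s / (p - s))"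
        using s by (simp add: powr_powr mult_left_mono)
      also have "\<dots> = (w powr (p - s) * y\<^sup>2) powr (s / (p - s))" using y by (simp add: powr_mult)
      also have "\<dots> \<le> (2 * B) powr (s / (p - s))"
        using \<open>\<not> 2 * B \<le> w powr (p - s) * y\<^sup>2\<close> s by (intro powr_mono2) auto
      finally show ?thesis .
    qed
    then have "B * (w powr s * y ^ (k + 1)) \<le> B * (2 * B) powr (s / (p - s))" using B by simp
    moreover have "0 \<le> y ^ (k + 3) * w powr p / 2" using y by simp
    ultimately show ?thesis by linarith
  qed
  ultimately show "B * (1 + w powr s) * y ^ (k + 1)
      \<le> y ^ (k + 3) * w powr p / 2 + (B + B * (2 * B) powr (s / (p - s)))"
    by (simp only: distrib_left distrib_right mult_1_right mult.assoc)
qed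

text \<open>The upper limit controls \<open>G\<close> only for large arguments; on the remaining
  bounded range continuity gives a constant, which the summand 1 accommodates.\<close>

lemma primitive_polynomial_bound:
  fixes G :: "real \<Rightarrow> 'a::real_normed_vector"
  assumes cont: "continuous_on UNIV G" and s: "q \<le> s" "0 \<le> s"
    and lim: "Limsup at_top (\<lambda>\<omega>. ereal (norm (G \<omega>) / \<omega> powr q)) < \<infinity>"
  obtains A where "A \<ge> 0" "\<And>\<omega>. 0 < \<omega> \<Longrightarrow> norm (G \<omega>) \<le> A * (1 + \<omega> powr s)"
proof -
  obtain c where "Limsup at_top (\<lambda>\<omega>. ereal (norm (G \<omega>) / \<omega> powr q)) < ereal c"
    using lim less_PInf_Ex_of_nat by (metis ereal_dense2)
  from Limsup_lessD[OF this] obtain W where W: "\<And>\<omega>. W \<le> \<omega> \<Longrightarrow> norm (G \<omega>) / \<omega> powr q < c"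
    by (auto simp: eventually_at_top_linorder)
  \<comment> \<open>Beyond 1 a larger exponent gives a larger power, so \<open>q\<close> may be
    replaced by \<open>s\<close> even if \<open>q\<close> is negative.\<close>
  define V where "V = max 1 W"
  have cV: "continuous_on {0..V} G" using cont by (rule continuous_on_subset) simp
  obtain A1 where A1: "A1 \<ge> 0" "\<And>\<omega>. \<omega> \<in> {0..V} \<Longrightarrow> norm (G \<omega>) \<le> A1"
    by (rule compact_continuous_bound[OF compact_Icc cV], rule that)
  define A where "A = A1 + \<bar>c\<bar>"
  show ?thesis
  proof (rule that[of A])
    show "A \<ge> 0" using A1 by (simp add: A_def)
    fix \<omega> :: real assume \<omega>: "0 < \<omega>"
    show "norm (G \<omega>) \<le> A * (1 + \<omega> powr s)"
    proof (cases "\<omega> \<le> V")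
      case True
      then have "norm (G \<omega>) \<le> A" using A1(2)[of \<omega>] \<omega> by (simp add: A_def)
      also have "\<dots> \<le> A * (1 + \<omega> powr s)" using \<open>A \<ge> 0\<close> by (simp add: distrib_left)
      finally show ?thesis .
    next
      case False
      then have 1: "1 \<le> \<omega>" "W \<le> \<omega>" by (auto simp: V_def)
      have "norm (G \<omega>) \<le> c * \<omega> powr q" using W[OF 1(2)] \<omega> by (simp add: divide_less_eq)
      also have "\<dots> \<le> A * \<omega> powr s"
        using 1 s A1 by (intro mult_mono powr_mono) (auto simp: A_def)
      also have "\<dots> \<le> A * (1 + \<omega> powr s)" using \<open>A \<ge> 0\<close> by (simp add: distrib_left)
      finally show ?thesis .
    qed
  qed
qed

text \<open>Two derivatives cost at most two powers of \<open>y\<close>. Factors of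
  \<open>norm (x - z)\<close> are harmless, since \<open>r \<le> 1\<close> makes \<open>y\<close>
  vanish where this norm exceeds 1, and \<open>y \<le> 1\<close> allows higher powers to be lowered
  to \<open>n + 1\<close>.\<close>

lemma cutoff_derivative_bounds:
  fixes x z :: "'a::euclidean_space"
  assumes y_def: "y = max 0 (r\<^sup>2 - (x - z) \<bullet> (x - z))" and r: "0 < r" "r \<le> 1"
  shows "norm ((- 2 * real (n + 3) * y ^ (n + 2)) *\<^sub>R (x - z)) \<le> 2 * real (n + 3) * y ^ (n + 1)"
    and "\<bar>\<Sum>i\<in>Basis. ((4 * real (n + 3) * real (n + 2) * y ^ (n + 1) * ((x - z) \<bullet> i)) *\<^sub>R (x - z)
       + (- 2 * real (n + 3) * y ^ (n + 2)) *\<^sub>R i) \<bullet> i\<bar>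
     \<le> (4 * real (n + 3) * real (n + 2) + 2 * real (n + 3) * real DIM('a)) * y ^ (n + 1)"
proof -
  have r2: "r\<^sup>2 \<le> 1" using r by (simp add: power_le_one)
  have y: "0 \<le> y" "y \<le> 1"
    using r2 inner_ge_zero[of "x - z"] by (auto simp: y_def simp del: inner_ge_zero)
  have yp: "y ^ (n + 2) \<le> y ^ (n + 1)" using y by (intro power_decreasing) auto
  have out: "y = 0" if "norm (x - z) > 1"
  proof -
    have "1 < (norm (x - z))\<^sup>2" using that by simp
    then show ?thesis using r2 by (simp add: y_def dot_square_norm)
  qed
  have yn: "y ^ (n + 1) * norm (x - z) ^ j \<le> y ^ (n + 1)" for j
    using out y by (cases "norm (x - z) > 1") (auto intro!: mult_left_le power_le_one)
  have "norm ((- 2 * real (n + 3) * y ^ (n + 2)) *\<^sub>R (x - z)) = 2 * real (n + 3) * (y * (y ^ (n + 1) * norm (x - z) ^ 1))"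
    using y by (simp add: abs_mult power_add)
  also have "\<dots> \<le> 2 * real (n + 3) * (1 * y ^ (n + 1))"
    using y yn[of 1] by (intro mult_left_mono mult_mono) auto
  finally show "norm ((- 2 * real (n + 3) * y ^ (n + 2)) *\<^sub>R (x - z)) \<le> 2 * real (n + 3) * y ^ (n + 1)"
    by simp
  have "(\<Sum>i\<in>Basis. ((4 * real (n + 3) * real (n + 2) * y ^ (n + 1) * ((x - z) \<bullet> i)) *\<^sub>R (x - z)
       + (- 2 * real (n + 3) * y ^ (n + 2)) *\<^sub>R i) \<bullet> i)
    = (\<Sum>i\<in>Basis. (4 * real (n + 3) * real (n + 2) * y ^ (n + 1)) * (((x - z) \<bullet> i) * ((x - z) \<bullet> i))
       + (- 2 * real (n + 3) * y ^ (n + 2)))"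
    by (intro sum.cong refl) (simp add: inner_add_left)
  also have "\<dots> = (4 * real (n + 3) * real (n + 2)) * (y ^ (n + 1) * norm (x - z) ^ 2)
      - 2 * real (n + 3) * real DIM('a) * y ^ (n + 2)"
    by (simp add: sum.distrib sum_distrib_left[symmetric] euclidean_inner[symmetric] dot_square_norm)
      (simp add: algebra_simps)
  finally have eq: "(\<Sum>i\<in>Basis. ((4 * real (n + 3) * real (n + 2) * y ^ (n + 1) * ((x - z) \<bullet> i)) *\<^sub>R (x - z)
       + (- 2 * real (n + 3) * y ^ (n + 2)) *\<^sub>R i) \<bullet> i) = \<dots>" .
  have 1: "(4 * real (n + 3) * real (n + 2)) * (y ^ (n + 1) * norm (x - z) ^ 2)
      \<le> (4 * real (n + 3) * real (n + 2)) * y ^ (n + 1)"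
    using yn[of 2] by (intro mult_left_mono) auto
  have 2: "2 * real (n + 3) * real DIM('a) * y ^ (n + 2) \<le> 2 * real (n + 3) * real DIM('a) * y ^ (n + 1)"
    using yp by (intro mult_left_mono) auto
  have 3: "0 \<le> (4 * real (n + 3) * real (n + 2)) * (y ^ (n + 1) * norm (x - z) ^ 2)"
    "0 \<le> 2 * real (n + 3) * real DIM('a) * y ^ (n + 2)" using y by auto
  show "\<bar>\<Sum>i\<in>Basis. ((4 * real (n + 3) * real (n + 2) * y ^ (n + 1) * ((x - z) \<bullet> i)) *\<^sub>R (x - z)
       + (- 2 * real (n + 3) * y ^ (n + 2)) *\<^sub>R i) \<bullet> i\<bar>
     \<le> (4 * real (n + 3) * real (n + 2) + 2 * real (n + 3) * real DIM('a)) * y ^ (n + 1)"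
    unfolding eq distrib_right using 1 2 3 by (simp only: abs_le_iff) linarith
qed

section \<open>Superlinear growth of the weighted mass\<close>

context global_positive_solution
begin

text \<open>Absorption and Jensen's inequality give the differential inequality for \<open>M\<close>
  at all positive times; the hypothesis \<open>levels\<close> supplies a time at which
  \<open>M\<close> is past the threshold of \<open>superlinear_growth_impossible\<close>.\<close>

lemma unbounded_growth_impossible:
  fixes G :: "real \<Rightarrow> 'a"
  assumes G: "\<And>\<omega>. (G has_vector_derivative g \<omega>) (at \<omega>)"
    and Gb: "\<And>\<omega>. 0 < \<omega> \<Longrightarrow> norm (G \<omega>) \<le> A * (1 + \<omega> powr s)" "A \<ge> 0"
    and s: "1 \<le> s" "s < p"
    and levels: "\<And>L. 0 < L \<Longrightarrow> \<exists>t>0. \<forall>x\<in>closure \<Omega>. L \<le> u x t"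
  shows False
proof -
  obtain x0 where x0: "x0 \<in> \<Omega>" using ne by blast
  obtain a b where ab: "cbox a b \<subseteq> \<Omega>" "x0 \<in> box a b"
    by (rule open_contains_cbox[OF op x0], rule that)
  have bc: "cbox a b \<subseteq> closure \<Omega>" using ab closure_subset by blast
  obtain \<rho> where \<rho>: "\<rho> > 0" "cball x0 \<rho> \<subseteq> box a b"
    using open_contains_cball[of "box a b"] ab(2) by auto
  \<comment> \<open>The integrals run over a box in \<open>\<Omega>\<close> and the weight lives on
    a ball in that box; radius at most 1 is what \<open>cutoff_derivative_bounds\<close> asks
    for.\<close>
  define r where "r = min 1 \<rho>"
  have r: "0 < r" "r \<le> 1" using \<rho> by (auto simp: r_def)
  have cb: "cball x0 r \<subseteq> cbox a b" using \<rho>(2) box_subset_cbox[of a b] by (force simp: r_def)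
  \<comment> \<open>An exponent large enough for \<open>weighted_absorption\<close>.\<close>
  define k where "k = nat \<lceil>2 * s / (p - s)\<rceil>"
  have k: "2 * s / (p - s) \<le> real (k + 1)" unfolding k_def by linarith
  define P where "P = (\<lambda>x. max 0 (r\<^sup>2 - (x - x0) \<bullet> (x - x0)))"
  define \<zeta> where "\<zeta> = (\<lambda>x. P x ^ (k + 3))"
  define Z where "Z = (\<lambda>x. (- 2 * real (k + 3) * P x ^ (k + 2)) *\<^sub>R (x - x0))"
  define Y where "Y = (\<lambda>x h. (4 * real (k + 3) * real (k + 2) * P x ^ (k + 1) * ((x - x0) \<bullet> h)) *\<^sub>R (x - x0)
       + (- 2 * real (k + 3) * P x ^ (k + 2)) *\<^sub>R h)"
  have \<zeta>: "C2_derivs \<zeta> Z Y"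
    unfolding \<zeta>_def Z_def Y_def by (rule C2_derivs_cutoff[OF P_def])
  have r2: "r\<^sup>2 \<le> 1" using r by (simp add: power_le_one)
  have P: "0 \<le> P x" "P x \<le> 1" for x
    using r2 inner_ge_zero[of "x - x0"] by (auto simp: P_def simp del: inner_ge_zero)
  have \<zeta>0: "0 \<le> \<zeta> x" for x using P by (simp add: \<zeta>_def)
  have P0: "P x = 0" if "x \<notin> cball x0 r" for x
  proof -
    have "r\<^sup>2 \<le> (norm (x - x0))\<^sup>2"
      using that r by (intro power_mono) (auto simp: dist_norm norm_minus_commute)
    then show ?thesis by (simp add: P_def dot_square_norm)
  qed
  define c1 where "c1 = 2 * real (k + 3)"
  define c2 where "c2 = 4 * real (k + 3) * real (k + 2) + 2 * real (k + 3) * real DIM('a)"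
  have c: "0 < c1" "0 < c2" by (auto simp: c1_def c2_def intro!: add_pos_nonneg)
  have Zb: "norm (Z x) \<le> c1 * P x ^ (k + 1)" for x
    unfolding Z_def c1_def by (rule cutoff_derivative_bounds(1)[OF _ r]) (simp add: P_def)
  have Yb: "\<bar>\<Sum>i\<in>Basis. Y x i \<bullet> i\<bar> \<le> c2 * P x ^ (k + 1)" for x
    unfolding Y_def c2_def by (rule cutoff_derivative_bounds(2)[OF _ r]) (simp add: P_def)
  \<comment> \<open>The common coefficient of \<open>(1 + u x t powr s) * P x ^ (k + 1)\<close> in
    the bounds for the drift term (\<open>c1 * A\<close>) and the Laplacian term
    (\<open>c2\<close>).\<close>
  define B where "B = c1 * A + c2"
  have B: "0 < B" using c Gb by (simp add: B_def add_nonneg_pos)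
  have s0: "0 \<le> s" using s by simp
  obtain C where C: "C > 0" "\<And>y w. 0 \<le> y \<Longrightarrow> y \<le> 1 \<Longrightarrow> 0 < w \<Longrightarrow>
    B * (1 + w powr s) * y ^ (k + 1) \<le> y ^ (k + 3) * w powr p / 2 + C"
    by (rule weighted_absorption[OF s0 s(2) B k], rule that)
  have lower: "\<zeta> x * u x t powr p / 2 - C
      \<le> \<zeta> x * u x t powr p + u x t * (\<Sum>i\<in>Basis. Y x i \<bullet> i) + Z x \<bullet> G (u x t)"
    if "x \<in> closure \<Omega>" "0 < t" for x t
  proof -
    have u0: "0 < u x t" using pos that by simp
    have Pk: "0 \<le> P x ^ (k + 1)" using P by simp
    \<comment> \<open>Here \<open>1 \<le> s\<close> is needed: the linear term from the Laplacian
      must fit the same growth bound as \<open>G\<close>.\<close>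
    have u1: "u x t \<le> 1 + u x t powr s"
    proof (cases "u x t \<le> 1")
      case False
      then have "u x t powr 1 \<le> u x t powr s" using s by (intro powr_mono) auto
      then show ?thesis using False by simp
    qed (simp add: add_increasing2)
    have "\<bar>u x t * (\<Sum>i\<in>Basis. Y x i \<bullet> i)\<bar> \<le> (1 + u x t powr s) * (c2 * P x ^ (k + 1))"
      unfolding abs_mult using u0 u1 Yb[of x] by (intro mult_mono) auto
    moreover have "\<bar>Z x \<bullet> G (u x t)\<bar> \<le> (c1 * P x ^ (k + 1)) * (A * (1 + u x t powr s))"
      by (rule order_trans[OF Cauchy_Schwarz_ineq2])
         (use Zb[of x] Gb(1)[OF u0] c Pk in \<open>intro mult_mono, auto\<close>)
    moreover have "(1 + u x t powr s) * (c2 * P x ^ (k + 1)) + (c1 * P x ^ (k + 1)) * (A * (1 + u x t powr s))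
        = B * (1 + u x t powr s) * P x ^ (k + 1)"
      by (simp add: B_def algebra_simps)
    moreover have "\<dots> \<le> \<zeta> x * u x t powr p / 2 + C"
      unfolding \<zeta>_def by (rule C(2)[OF P u0])
    ultimately show ?thesis by linarith
  qed
  define M where "M = (\<lambda>t. integral (cbox a b) (\<lambda>x. \<zeta> x * u x t))"
  define M' where "M' = (\<lambda>t. integral (cbox a b) (\<lambda>x. \<zeta> x * ut x t))"
  have c\<zeta>: "continuous_on S \<zeta>" for S by (rule C2_derivsD(4)[OF \<zeta>])
  have dM: "(M has_real_derivative M' t) (at t)" if "0 < t" for t
    unfolding M_def M'_def by (rule weighted_mass_derivative[OF c\<zeta> ab(1) that])
  have i\<zeta>: "\<zeta> integrable_on cbox a b" by (intro integrable_continuous c\<zeta>)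
  have cu: "continuous_on (cbox a b) (\<lambda>x. u x t)" if "0 < t" for t
    by (rule continuous_on_closure_slice[OF cont_u bc that])
  have iM: "(\<lambda>x. \<zeta> x * u x t) integrable_on cbox a b" if "0 < t" for t
    by (intro integrable_continuous continuous_intros c\<zeta> cu that)
  define \<Phi> where "\<Phi> = integral (cbox a b) \<zeta>"
  have \<Phi>: "0 < \<Phi>"
  proof (rule ccontr)
    assume "\<not> 0 < \<Phi>"
    moreover have "0 \<le> \<Phi>" unfolding \<Phi>_def by (intro integral_nonneg i\<zeta> \<zeta>0)
    ultimately have "(\<zeta> has_integral 0) (cbox a b)"
      using integrable_integral[OF i\<zeta>] by (simp add: \<Phi>_def)
    then have "\<zeta> x0 = 0"
      by (rule has_integral_0_cbox_imp_0[OF c\<zeta> \<zeta>0]) (use ab(2) box_subset_cbox[of a b] in auto)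
    then show False using r by (simp add: \<zeta>_def P_def)
  qed
  have Mge: "L * \<Phi> \<le> M t" if "0 < t" "\<And>x. x \<in> cbox a b \<Longrightarrow> L \<le> u x t" for L t
  proof -
    have "L * \<Phi> = integral (cbox a b) (\<lambda>x. \<zeta> x * L)" by (simp add: \<Phi>_def mult.commute)
    also have "\<dots> \<le> M t" unfolding M_def
      using that \<zeta>0 i\<zeta> by (intro integral_le iM integrable_on_mult_left mult_left_mono) auto
    finally show ?thesis .
  qed
  have Mpos: "0 < M t" if t: "0 < t" for t
  proof -
    have "cbox a b \<noteq> {}" using ab(2) box_subset_cbox[of a b] by auto
    then obtain x where x: "x \<in> cbox a b" "\<And>y. y \<in> cbox a b \<Longrightarrow> u x t \<le> u y t"
      using continuous_attains_inf[OF compact_cbox _ cu[OF t]] by blast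
    then have "u x t * \<Phi> \<le> M t" by (intro Mge t)
    moreover have "0 < u x t * \<Phi>" using pos[of x t] x bc t \<Phi> by auto
    ultimately show ?thesis by simp
  qed
  \<comment> \<open>After absorption half of the reaction integral remains, and Jensen's inequality
    bounds that integral below by \<open>\<Phi> * (M t / \<Phi>) powr p\<close>.\<close>
  define \<alpha> where "\<alpha> = \<Phi> / (2 * \<Phi> powr p)"
  have \<alpha>: "0 < \<alpha>" using \<Phi> by (simp add: \<alpha>_def)
  \<comment> \<open>The summand 1 gives strict positivity without a discussion of the volume of the
    box.\<close>
  define C' where "C' = C * measure lborel (cbox a b) + 1"
  have C': "0 < C'" using C by (simp add: C'_def add_nonneg_pos)
  have M': "\<alpha> * M t powr p - C' \<le> M' t" if t: "0 < t" for t
  proof -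
    \<comment> \<open>Jensen's inequality: use the tangent line of \<open>x powr p\<close> at the weighted mean of \<open>u\<close>\<close>
    define \<mu> where "\<mu> = M t / \<Phi>"
    have \<mu>: "0 < \<mu>" using Mpos[OF t] \<Phi> by (simp add: \<mu>_def)
    have "M' t = integral (cbox a b)
        (\<lambda>x. \<zeta> x * u x t powr p + u x t * (\<Sum>i\<in>Basis. Y x i \<bullet> i) + Z x \<bullet> G (u x t))" (is "_ = integral _ ?R")
      unfolding M'_def
      by (rule weak_formulation[OF G \<zeta> _ _ _ closed_cball cb ab(1) t])
         (use P0 in \<open>auto simp: \<zeta>_def Z_def Y_def\<close>)
    moreover have "integral (cbox a b) (\<lambda>x. p * \<mu> powr (p - 1) / 2 * (\<zeta> x * u x t) - (p - 1) * \<mu> powr p / 2 * \<zeta> x - C)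
        \<le> integral (cbox a b) ?R"
    proof (rule integral_le)
      show "(\<lambda>x. p * \<mu> powr (p - 1) / 2 * (\<zeta> x * u x t) - (p - 1) * \<mu> powr p / 2 * \<zeta> x - C) integrable_on cbox a b"
        by (intro integrable_continuous continuous_intros c\<zeta> cu t)
      have Gc: "continuous_on UNIV G"
        using G by (meson continuous_at_imp_continuous_on has_vector_derivative_continuous)
      have "continuous_on (cbox a b) (\<lambda>x. G (u x t))"
        by (rule continuous_on_compose2[OF Gc cu[OF t]]) simp
      moreover have "\<forall>x\<in>cbox a b. u x t \<noteq> 0" using pos[OF _ t] bc by (metis less_irrefl subset_iff)
      ultimately show "?R integrable_on cbox a b"
        by (intro integrable_continuous continuous_intros C2_derivsD[OF \<zeta>] cu t) auto
      fix x assume "x \<in> cbox a b"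
      then have x: "x \<in> closure \<Omega>" using bc by blast
      let ?l = "p * \<mu> powr (p - 1) * u x t - (p - 1) * \<mu> powr p"
      have "\<zeta> x * ?l \<le> \<zeta> x * u x t powr p"
        by (intro mult_left_mono powr_tangent_line p1 pos x t \<mu> \<zeta>0)
      moreover have "p * \<mu> powr (p - 1) / 2 * (\<zeta> x * u x t) - (p - 1) * \<mu> powr p / 2 * \<zeta> x = \<zeta> x * ?l / 2"
        by (simp add: right_diff_distrib diff_divide_distrib mult_ac)
      ultimately show "p * \<mu> powr (p - 1) / 2 * (\<zeta> x * u x t) - (p - 1) * \<mu> powr p / 2 * \<zeta> x - C \<le> ?R x"
        using lower[OF x t] by linarith
    qed
    moreover have "integral (cbox a b) (\<lambda>x. p * \<mu> powr (p - 1) / 2 * (\<zeta> x * u x t) - (p - 1) * \<mu> powr p / 2 * \<zeta> x - C)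
        = p * \<mu> powr (p - 1) / 2 * M t - (p - 1) * \<mu> powr p / 2 * \<Phi> - C * measure lborel (cbox a b)"
    proof -
      have "((\<lambda>x. p * \<mu> powr (p - 1) / 2 * (\<zeta> x * u x t) - (p - 1) * \<mu> powr p / 2 * \<zeta> x - C) has_integral
        p * \<mu> powr (p - 1) / 2 * M t - (p - 1) * \<mu> powr p / 2 * \<Phi> - measure lborel (cbox a b) *\<^sub>R C) (cbox a b)"
        unfolding M_def \<Phi>_def
        by (intro has_integral_diff has_integral_mult_right integrable_integral iM i\<zeta> t has_integral_const)
      then show ?thesis by (simp add: integral_unique mult.commute)
    qed
    moreover have "p * \<mu> powr (p - 1) / 2 * M t - (p - 1) * \<mu> powr p / 2 * \<Phi> = \<alpha> * M t powr p"
    proof -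
      have Mt: "M t = \<mu> * \<Phi>" using \<Phi> by (simp add: \<mu>_def)
      have "\<mu> powr (p - 1) * \<mu> = \<mu> powr p" using \<mu> by (simp add: powr_mult_base mult.commute)
      then have "p * \<mu> powr (p - 1) / 2 * M t = p * \<mu> powr p / 2 * \<Phi>"
        by (metis Mt mult.assoc mult.left_commute times_divide_eq_left)
      moreover have "\<alpha> * M t powr p = \<mu> powr p * \<Phi> / 2"
        using \<mu> \<Phi> by (simp add: \<alpha>_def Mt powr_mult)
      moreover have "p * X / 2 * \<Phi> - (p - 1) * X / 2 * \<Phi> = X * \<Phi> / 2" for X
        by (simp add: left_diff_distrib diff_divide_distrib)
      ultimately show ?thesis by (simp only:)
    qed
    ultimately show ?thesis by (simp add: C'_def)
  qed
  \<comment> \<open>Chosen so that \<open>\<alpha> * (L * \<Phi>) powr p\<close> equals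
    \<open>2 * C'\<close>, the threshold for the mass.\<close>
  define L where "L = (2 * C' / \<alpha>) powr (1 / p) / \<Phi>"
  have L: "0 < L" using C' \<alpha> \<Phi> by (simp add: L_def)
  obtain t1 where t1: "0 < t1" "\<And>x. x \<in> closure \<Omega> \<Longrightarrow> L \<le> u x t1" using levels[OF L] by blast
  have "L * \<Phi> \<le> M t1" using t1 bc by (intro Mge) auto
  then have "(2 * C' / \<alpha>) powr (1 / p) \<le> M t1" using \<Phi> by (simp add: L_def)
  then have "((2 * C' / \<alpha>) powr (1 / p)) powr p \<le> M t1 powr p" using p1 by (intro powr_mono2) auto
  then have "2 * C' / \<alpha> \<le> M t1 powr p" using p1 C' \<alpha> by (simp add: powr_powr)
  then have init: "2 * C' \<le> \<alpha> * M t1 powr p" using \<alpha> by (simp add: divide_le_eq mult.commute)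
  show False
    by (rule superlinear_growth_impossible[OF p1 \<alpha> C', of t1 M M'])
       (use t1 dM Mpos M' init in auto)
qed

end

section \<open>Finite maximal time, by contradiction\<close>

theorem theorem4p2:
  fixes \<Omega> :: "'a::euclidean_space set"
    and p q :: real
    and g G :: "real \<Rightarrow> 'a"
    and \<sigma> :: "'a \<Rightarrow> real \<Rightarrow> real"
    and u0 :: "'a \<Rightarrow> real"
    and T :: ereal
    and u :: "'a \<Rightarrow> real \<Rightarrow> real"
  assumes "bounded_C2_domain \<Omega>"
    and "p > 1" and "q < p"
    and "g C1_differentiable_on UNIV"
    and "\<And>\<omega>. (G has_vector_derivative g \<omega>) (at \<omega>)"
    and "Limsup at_top (\<lambda>\<omega>. ereal (norm (G \<omega>) / \<omega> powr q)) < \<infinity>"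
    and "C1_bounded_on (frontier \<Omega> \<times> {0<..}) (\<lambda>(x, t). \<sigma> x t)"
    and "\<And>x t. x \<in> frontier \<Omega> \<Longrightarrow> 0 < t \<Longrightarrow> 0 \<le> \<sigma> x t"
    and "continuous_on (closure \<Omega>) u0"
    and "\<And>x. x \<in> closure \<Omega> \<Longrightarrow> 0 \<le> u0 x"
    and "\<exists>x\<in>closure \<Omega>. u0 x \<noteq> 0"
    and "maximal_classical_solution \<Omega> p g \<sigma> u0 T u"
    and "\<And>x t. x \<in> closure \<Omega> \<Longrightarrow> 0 < t \<Longrightarrow> ereal t < T \<Longrightarrow> 0 < u x t"
  shows "T < \<infinity>"
proof (rule ccontr)
  assume "\<not> T < \<infinity>"
  then have T: "T = \<infinity>" by simp
  have dom: "open \<Omega>" "\<Omega> \<noteq> {}" "bounded \<Omega>" "C2_boundary \<Omega>"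
    using assms(1) by (auto simp: bounded_C2_domain_def)
  have sol: "classical_solution \<Omega> p g \<sigma> u0 \<infinity> u"
    using assms(12) by (simp add: maximal_classical_solution_def T)
  then obtain ut Du D2u where C21: "C21_derivatives \<Omega> \<infinity> u ut Du D2u"
    and pde: "\<forall>x\<in>closure \<Omega>. \<forall>t. 0 < t \<and> ereal t < \<infinity> \<longrightarrow>
           ut x t = (\<Sum>i\<in>Basis. D2u x t i \<bullet> i) - g (u x t) \<bullet> Du x t + u x t powr p"
    and bc: "\<forall>x\<in>frontier \<Omega>. \<forall>t. 0 < t \<and> ereal t < \<infinity> \<longrightarrow>
           \<sigma> x t * ut x t + Du x t \<bullet> outer_unit_normal \<Omega> x = 0"
    unfolding classical_solution_def by blast
  have I: "{t. 0 < t \<and> ereal t < \<infinity>} = {0<..}" by auto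
  interpret global_positive_solution \<Omega> p g u ut Du D2u
  proof
    show "continuous_on UNIV g" using assms(4) by (rule C1_differentiable_imp_continuous_on)
    show "continuous_on (closure \<Omega> \<times> {0<..}) (\<lambda>(x, t). u x t)"
      using sol unfolding classical_solution_def
      by (elim conjE, elim continuous_on_subset) auto
    show "0 < u x t" if "x \<in> closure \<Omega>" "0 < t" for x t
      using assms(13) that T by simp
  qed (use dom assms(2) pde C21[unfolded C21_derivatives_def Let_def I] in auto)
  obtain \<phi> D H where \<phi>: "C2_derivs \<phi> D H"
    "\<And>x. x \<in> frontier \<Omega> \<Longrightarrow> D x \<bullet> outer_unit_normal \<Omega> x \<le> -1"
    by (rule boundary_barrier[OF dom(1,3,4)], rule that)
  \<comment> \<open>Existence of the outer normal at every boundary point is a by-product of the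
    local barrier construction.\<close>
  have n: "is_outer_unit_normal \<Omega> x (outer_unit_normal \<Omega> x)" if "x \<in> frontier \<Omega>" for x
    by (rule local_boundary_barrier[OF dom(1,4) that])
  have "bounded ((\<lambda>(x, t). \<sigma> x t) ` (frontier \<Omega> \<times> {0<..}))"
    using assms(7) by (simp add: C1_bounded_on_def)
  then obtain S0 where S0: "\<And>x t. x \<in> frontier \<Omega> \<Longrightarrow> 0 < t \<Longrightarrow> \<bar>\<sigma> x t\<bar> \<le> S0"
    by (force simp: bounded_iff)
  \<comment> \<open>The maximum with 0 provides the nonnegative bound required by
    \<open>exceeds_any_level\<close>.\<close>
  have S: "\<sigma> x t \<le> max 0 S0" if "x \<in> frontier \<Omega>" "0 < t" for x t
    using S0[OF that] by linarith
  have levels: "\<exists>t>0. \<forall>x\<in>closure \<Omega>. L \<le> u x t" if "0 < L" for L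
    by (rule exceeds_any_level[OF \<phi> n _ assms(8) S _ that]) (use bc in auto)
  \<comment> \<open>One exponent for both lower-order terms: 1 for the Laplacian, \<open>q\<close>
    for the primitive \<open>G\<close>. It is below \<open>p\<close> since \<open>p\<close> exceeds
    both.\<close>
  define s where "s = max 1 q"
  have s: "1 \<le> s" "s < p" "q \<le> s" "0 \<le> s" using assms(2,3) by (auto simp: s_def)
  have "continuous_on UNIV G"
    using assms(5) by (meson continuous_at_imp_continuous_on has_vector_derivative_continuous)
  then obtain A where A: "A \<ge> 0" "\<And>\<omega>. 0 < \<omega> \<Longrightarrow> norm (G \<omega>) \<le> A * (1 + \<omega> powr s)"
    using primitive_polynomial_bound[OF _ s(3,4) assms(6)] by metis
  show False
    by (rule unbounded_growth_impossible[OF assms(5) A(2,1) s(1,2) levels])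
qed

end
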